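(* Let $\beta$ be a well-formed execution of the SODA$_{\text{err}}$ algorithm described in the context. Then every operation in $\beta$ invoked by a non-faulty client completes.
   Context: System model: asynchronous message passing with writers $\mathcal{W}$, readers $\mathcal{R}$ and $n$ servers $\mathcal{S}$ ordered $s_1<\dots<s_n$; reliable point-to-point channels between every client and server and every two servers (eventual delivery to non-crashed destinations even if the sender crashes; arbitrary delays and order). Crash failures only; any number of clients and at most $f$ servers crash, $1\le f\le (n-1)/2$. Well-formed: each client invokes an operation only after its previous one completed. Errors: when a server sends its locally stored coded element to a reader (in response to the reader's registration), the element read from its disk may be erroneous (an arbitrary field element instead of the correct one), without the server knowing; at most $e$ such erroneous coded elements occur, while tags, metadata and coded elements merely relayed upon delivery from a write are never erroneous. Coding: an $[n,k]$ MDS code with $k=n-f-2e$, encoder $\Phi$ ($\Phi_s(v)$ coded element for server $s$), and decoder $\Phi_{err}^{-1}$ which recovers $v$ from any $k+2e$ coded elements (with known indices) of which at most $e$ are erroneous. Tags $t=(z,w)$, $z\in\mathbb{N}$, $w\in\mathcal{W}$, ordered lexicographically; initial tag $t_0$; initial value $v_0$. Dissemination primitives. md-value-send$(t,v)$: $(t,v)$ sent to $s_1,\dots,s_{f+1}$; each $s_i$ on first receipt forwards it to $s_{i+1},\dots,s_{f+1}$, sends $(t,\Phi_{s'}(v))$ to every other server $s'$, and delivers $(t,\Phi_{s_i}(v))$; other servers deliver the received coded element (md-value-deliver). md-meta-send$(m)$: same, delivering $m$ itself at every server (md-meta-deliver). SODA$_{\text{err}}$ write$(v)$ at $w$: query tags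 of all servers, wait for a majority, take max $t_{max}$; $t_w=(t_{max}.z+1,w)$; md-value-send$(t_w,v)$; wait for $k$ acknowledgments. SODA$_{\text{err}}$ read at $r$: query tags, wait for a majority, take max $t_r$; md-meta-send(READ-VALUE,$(r,t_r)$); collect pairs $(t,c)$ until $k+2e$ of them from distinct servers share a tag; decode with $\Phi_{err}^{-1}$; md-meta-send(READ-COMPLETE,$(r,t_r)$); return value. SODA$_{\text{err}}$ server $s$: state $(t,c_s)$ (initially $(t_0,\Phi_s(v_0))$), set $R_c$ of registered $(r,t_r)$, set $H$ of triples $(t,s',r)$, both initially empty. Replies to tag queries with its tag. On md-value-deliver$(t_w,c'_s)$: for each $(r,t_r)\in R_c$ with $t_w\ge t_r$, send $(t_w,c'_s)$ to $r$, add $(t_w,s,r)$ to $H$, md-meta-send(READ-DISPERSE,$(t_w,s,r)$); if $t_w>t$ store $(t_w,c'_s)$; acknowledge the writer. On md-meta-deliver(READ-VALUE,$(r,t_r)$): if $(t_0,s,r)\in H$ remove $r$'s triples from $H$; else register $(r,t_r)$ in $R_c$ and if $t\ge t_r$ send $(t,c_s)$ to $r$, add $(t,s,r)$ to $H$, md-meta-send(READ-DISPERSE,$(t,s,r)$). On md-meta-deliver(READ-COMPLETE,$(r,t_r)$): if $r$ is registered, unregister it and remove its triples from $H$; else add $(t_0,s,r)$ to $H$. On md-meta-deliver(READ-DISPERSE,$(t,s',r)$): add it to $H$; if $r$ is registered and $H$ has at least $k+2e$ triples with tag $t$ and reader $r$, unregister $r$ and remove its triples from $H$.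
   Formalization: In R_c, H and the READ messages, r is a read identifier (reader, operation counter), and replies carry the counter; with r just the reader, a leftover (t_0,s,r) in H can block r's next read forever. Servers run through R_c in a fixed order. *)

theory Defs
  imports Main "HOL-Library.Product_Lexorder"
begin

text \<open>Tags are pairs (z, w) of a natural number and a writer identifier (writers are
identified by natural numbers), ordered lexicographically (Product_Lexorder).
The initial tag t0 = (0,0) lies below every tag (z+1, w) produced by a write.
A read operation is identified by the pair (reader id, operation counter of that reader).\<close>

type_synonym tag = "nat \<times> nat"
type_synonym rid = "nat \<times> nat"

definition t0 :: tag where "t0 = (0, 0)"

text \<open>Processes: servers s_1 < ... < s_n are Srv 0, ..., Srv (n-1); writers and readers.\<close>
datatype proc = Srv nat | Wr nat | Rd nat

datatype meta =
    ReadValue rid tag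
  | ReadComplete rid tag
  | ReadDisperse tag nat rid

datatype ('v, 'c) msg =
    QTag nat                 \<comment> \<open>tag query of a client operation (operation counter)\<close>
  | RTag nat tag
  | VFull tag 'v nat          \<comment> \<open>md-value-send: full value (tag, value, writer operation counter)\<close>
  | VCoded tag 'c nat         \<comment> \<open>md-value-send: coded element relayed by s_i\<close>
  | Ack tag nat
  | MMeta meta               \<comment> \<open>md-meta-send: message to / forwarded among s_1..s_(f+1)\<close>
  | MMetaD meta              \<comment> \<open>md-meta-send: message relayed by s_i to the other servers\<close>
  | RResp rid tag 'c

text \<open>Packets in transit: (unique stamp, source, destination, message).\<close>
type_synonym ('v, 'c) pkt = "nat \<times> proc \<times> proc \<times> ('v, 'c) msg"

definition pkt_src :: "('v, 'c) pkt \<Rightarrow> proc" where "pkt_src x = fst (snd x)"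
definition pkt_dst :: "('v, 'c) pkt \<Rightarrow> proc" where "pkt_dst x = fst (snd (snd x))"
definition pkt_msg :: "('v, 'c) pkt \<Rightarrow> ('v, 'c) msg" where "pkt_msg x = snd (snd (snd x))"

record 'c sloc =
  stag :: tag
  selem :: 'c
  sR :: "(rid \<times> tag) set"
  sH :: "(tag \<times> nat \<times> rid) set"
  vseen :: "(tag \<times> nat) set"   \<comment> \<open>md-value messages already received (first receipt)\<close>
  mseen :: "meta set"           \<comment> \<open>md-meta messages already received (first receipt)\<close>

datatype ('v, 'c) phase =
    Idle
  | WQuery nat 'v "nat set" tag          \<comment> \<open>op counter, value, responders, max tag so far\<close>
  | WWait nat tag "nat set"              \<comment> \<open>op counter, t_w, servers that acknowledged\<close>
  | RQuery nat "nat set" tag             \<comment> \<open>op counter, responders, max tag so far\<close>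
  | RWait nat tag "nat \<Rightarrow> tag \<Rightarrow> 'c option" \<comment> \<open>op counter, t_r, first pair received per server and tag\<close>

record ('v, 'c) cloc =
  ph :: "('v, 'c) phase"
  cnt :: nat
  ret :: "'v option"

record ('v, 'c) gstate =
  crashed :: "proc set"
  net :: "('v, 'c) pkt set"
  nid :: nat
  errs :: nat          \<comment> \<open>number of erroneous coded elements sent so far\<close>
  srv :: "nat \<Rightarrow> 'c sloc"
  cli :: "proc \<Rightarrow> ('v, 'c) cloc"

record ('v, 'c) params =
  pn :: nat
  pf :: nat
  pe :: nat
  pPhi :: "nat \<Rightarrow> 'v \<Rightarrow> 'c"
  pDec :: "nat set \<Rightarrow> (nat \<Rightarrow> 'c) \<Rightarrow> 'v"

definition kk :: "('v, 'c) params \<Rightarrow> nat" where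
  "kk P = pn P - pf P - 2 * pe P"

text \<open>[n,k] MDS code: any k coordinates determine the codeword (minimum distance n-k+1).\<close>
definition mds_code :: "nat \<Rightarrow> nat \<Rightarrow> (nat \<Rightarrow> 'v \<Rightarrow> 'c) \<Rightarrow> bool" where
  "mds_code n k Phi \<longleftrightarrow> 1 \<le> k \<and> k \<le> n \<and>
     (\<forall>S v v'. S \<subseteq> {..<n} \<and> card S = k \<and> (\<forall>j\<in>S. Phi j v = Phi j v') \<longrightarrow> v = v')"

definition err_decoder :: "nat \<Rightarrow> nat \<Rightarrow> nat \<Rightarrow> (nat \<Rightarrow> 'v \<Rightarrow> 'c) \<Rightarrow> (nat set \<Rightarrow> (nat \<Rightarrow> 'c) \<Rightarrow> 'v) \<Rightarrow> bool" where
  "err_decoder n k e Phi Dec \<longleftrightarrow>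
     (\<forall>S c v. S \<subseteq> {..<n} \<and> card S = k + 2 * e \<and> card {j\<in>S. c j \<noteq> Phi j v} \<le> e \<longrightarrow> Dec S c = v)"

definition md_meta :: "('v, 'c) params \<Rightarrow> meta \<Rightarrow> (proc \<times> ('v, 'c) msg) list" where
  "md_meta P m = map (\<lambda>i. (Srv i, MMeta m)) [0..<pf P + 1]"

definition remove_r :: "rid \<Rightarrow> (tag \<times> nat \<times> rid) set \<Rightarrow> (tag \<times> nat \<times> rid) set" where
  "remove_r r H = {x \<in> H. snd (snd x) \<noteq> r}"

definition registered :: "rid \<Rightarrow> (rid \<times> tag) set \<Rightarrow> bool" where
  "registered r R \<longleftrightarrow> (\<exists>tr. (r, tr) \<in> R)"

definition unreg :: "rid \<Rightarrow> (rid \<times> tag) set \<Rightarrow> (rid \<times> tag) set" where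
  "unreg r R = {x \<in> R. fst x \<noteq> r}"

definition value_deliver :: "('v, 'c) params \<Rightarrow> nat \<Rightarrow> tag \<Rightarrow> 'c \<Rightarrow> nat \<Rightarrow> 'c sloc
    \<Rightarrow> 'c sloc \<times> (proc \<times> ('v, 'c) msg) list" where
  "value_deliver P s t c oc L =
    (let regs = filter (\<lambda>(r, tr). tr \<le> t) (sorted_list_of_set (sR L));
         out = concat (map (\<lambda>(r, tr). (Rd (fst r), RResp r t c) # md_meta P (ReadDisperse t s r)) regs)
               @ [(Wr (snd t), Ack t oc)];
         L1 = L\<lparr>sH := sH L \<union> (\<lambda>(r, tr). (t, s, r)) ` set regs\<rparr>;
         L2 = (if stag L < t then L1\<lparr>stag := t, selem := c\<rparr> else L1)
     in (L2, out))"

text \<open>md-meta-deliver(m) at server s; eo = Some c' means the coded element read from disk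
is erroneous and equals c'. The boolean result tells whether an erroneous element was sent.\<close>
definition meta_deliver :: "('v, 'c) params \<Rightarrow> nat \<Rightarrow> meta \<Rightarrow> 'c option \<Rightarrow> 'c sloc
    \<Rightarrow> 'c sloc \<times> (proc \<times> ('v, 'c) msg) list \<times> bool" where
  "meta_deliver P s m eo L =
    (case m of
      ReadValue r tr \<Rightarrow>
        (if (t0, s, r) \<in> sH L then (L\<lparr>sH := remove_r r (sH L)\<rparr>, [], False)
         else (let L1 = L\<lparr>sR := insert (r, tr) (sR L)\<rparr> in
           if tr \<le> stag L then
             (let c = (case eo of None \<Rightarrow> selem L | Some c' \<Rightarrow> c') in
              (L1\<lparr>sH := insert (stag L, s, r) (sH L)\<rparr>,
               (Rd (fst r), RResp r (stag L) c) # md_meta P (ReadDisperse (stag L) s r),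
               eo \<noteq> None))
           else (L1, [], False)))
    | ReadComplete r tr \<Rightarrow>
        (if registered r (sR L) then (L\<lparr>sR := unreg r (sR L), sH := remove_r r (sH L)\<rparr>, [], False)
         else (L\<lparr>sH := insert (t0, s, r) (sH L)\<rparr>, [], False))
    | ReadDisperse t s' r \<Rightarrow>
        (let H1 = insert (t, s', r) (sH L) in
         if registered r (sR L) \<and> card {x. (t, x, r) \<in> H1} \<ge> kk P + 2 * pe P
         then (L\<lparr>sR := unreg r (sR L), sH := remove_r r H1\<rparr>, [], False)
         else (L\<lparr>sH := H1\<rparr>, [], False)))"

definition srv_recv :: "('v, 'c) params \<Rightarrow> nat \<Rightarrow> proc \<Rightarrow> ('v, 'c) msg \<Rightarrow> 'c option \<Rightarrow> 'c sloc
    \<Rightarrow> 'c sloc \<times> (proc \<times> ('v, 'c) msg) list \<times> bool" where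
  "srv_recv P s src m eo L =
    (case m of
      QTag oc \<Rightarrow> (L, [(src, RTag oc (stag L))], False)
    | VFull t v oc \<Rightarrow>
        (if (t, oc) \<in> vseen L then (L, [], False)
         else (let L1 = L\<lparr>vseen := insert (t, oc) (vseen L)\<rparr>;
                   fwd = map (\<lambda>j. (Srv j, VFull t v oc)) [Suc s..<pf P + 1]
                         @ map (\<lambda>j. (Srv j, VCoded t (pPhi P j v) oc)) (filter (\<lambda>j. j \<noteq> s) [0..<pn P]);
                   (L2, out) = value_deliver P s t (pPhi P s v) oc L1
               in (L2, fwd @ out, False)))
    | VCoded t c oc \<Rightarrow>
        (if s \<le> pf P \<or> (t, oc) \<in> vseen L then (L, [], False)
         else (let (L2, out) = value_deliver P s t c oc (L\<lparr>vseen := insert (t, oc) (vseen L)\<rparr>)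
               in (L2, out, False)))
    | MMeta mm \<Rightarrow>
        (if mm \<in> mseen L then (L, [], False)
         else (let L1 = L\<lparr>mseen := insert mm (mseen L)\<rparr>;
                   fwd = map (\<lambda>j. (Srv j, MMeta mm)) [Suc s..<pf P + 1]
                         @ map (\<lambda>j. (Srv j, MMetaD mm)) (filter (\<lambda>j. j \<noteq> s) [0..<pn P]);
                   (L2, out, u) = meta_deliver P s mm eo L1
               in (L2, fwd @ out, u)))
    | MMetaD mm \<Rightarrow>
        (if s \<le> pf P \<or> mm \<in> mseen L then (L, [], False)
         else meta_deliver P s mm eo (L\<lparr>mseen := insert mm (mseen L)\<rparr>))
    | _ \<Rightarrow> (L, [], False))"

datatype 'v input = InvWrite 'v | InvRead

definition cli_inv :: "('v, 'c) params \<Rightarrow> proc \<Rightarrow> 'v input \<Rightarrow> ('v, 'c) cloc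
    \<Rightarrow> (('v, 'c) cloc \<times> (proc \<times> ('v, 'c) msg) list) option" where
  "cli_inv P p i C =
    (if ph C \<noteq> Idle then None else
     (let oc = Suc (cnt C); qs = map (\<lambda>j. (Srv j, QTag oc)) [0..<pn P] in
      case (p, i) of
        (Wr w, InvWrite v) \<Rightarrow> Some (C\<lparr>ph := WQuery oc v {} t0, cnt := oc, ret := None\<rparr>, qs)
      | (Rd r, InvRead) \<Rightarrow> Some (C\<lparr>ph := RQuery oc {} t0, cnt := oc, ret := None\<rparr>, qs)
      | _ \<Rightarrow> None))"

definition cli_recv :: "('v, 'c) params \<Rightarrow> proc \<Rightarrow> proc \<Rightarrow> ('v, 'c) msg \<Rightarrow> ('v, 'c) cloc
    \<Rightarrow> ('v, 'c) cloc \<times> (proc \<times> ('v, 'c) msg) list" where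
  "cli_recv P p src m C =
    (case src of
      Srv j \<Rightarrow>
       (case (m, ph C) of
         (RTag oc t, WQuery oc' v S tm) \<Rightarrow>
           (if oc = oc' \<and> j \<notin> S then
              (let S' = insert j S; tm' = max tm t in
               if 2 * card S' > pn P then
                 (case p of
                   Wr w \<Rightarrow> (let tw = (fst tm' + 1, w) in
                             (C\<lparr>ph := WWait oc tw {}\<rparr>, map (\<lambda>i. (Srv i, VFull tw v oc)) [0..<pf P + 1]))
                 | _ \<Rightarrow> (C, []))
               else (C\<lparr>ph := WQuery oc v S' tm'\<rparr>, []))
            else (C, []))
       | (RTag oc t, RQuery oc' S tm) \<Rightarrow>
           (if oc = oc' \<and> j \<notin> S then
              (let S' = insert j S; tm' = max tm t in
               if 2 * card S' > pn P then
                 (case p of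
                   Rd r \<Rightarrow> (C\<lparr>ph := RWait oc tm' (\<lambda>_ _. None)\<rparr>, md_meta P (ReadValue (r, oc) tm'))
                 | _ \<Rightarrow> (C, []))
               else (C\<lparr>ph := RQuery oc S' tm'\<rparr>, []))
            else (C, []))
       | (Ack t oc, WWait oc' tw A) \<Rightarrow>
           (if oc = oc' \<and> t = tw then
              (let A' = insert j A in
               if card A' \<ge> kk P then (C\<lparr>ph := Idle\<rparr>, [])
               else (C\<lparr>ph := WWait oc' tw A'\<rparr>, []))
            else (C, []))
       | (RResp rd t c, RWait oc tr M) \<Rightarrow>
           (case p of
             Rd r \<Rightarrow>
               (if rd = (r, oc) \<and> M j t = None then
                  (let M' = M(j := (M j)(t := Some c)); S = {i. M' i t \<noteq> None} in
                   if card S \<ge> kk P + 2 * pe P then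
                     (C\<lparr>ph := Idle, ret := Some (pDec P S (\<lambda>i. the (M' i t)))\<rparr>,
                      md_meta P (ReadComplete (r, oc) tr))
                   else (C\<lparr>ph := RWait oc tr M'\<rparr>, []))
                else (C, []))
           | _ \<Rightarrow> (C, []))
       | _ \<Rightarrow> (C, []))
    | _ \<Rightarrow> (C, []))"

datatype ('v, 'c) action =
    Invoke proc "'v input" bool "(proc \<times> ('v, 'c) msg) list"
      \<comment> \<open>invocation; flag = process crashes during this step, list = messages actually sent\<close>
  | Receive "('v, 'c) pkt" "'c option" bool "(proc \<times> ('v, 'c) msg) list"
      \<comment> \<open>delivery of a packet; error choice; crash flag; messages actually sent\<close>
  | Crash proc
  | Skip

definition can_crash :: "('v, 'c) params \<Rightarrow> ('v, 'c) gstate \<Rightarrow> proc \<Rightarrow> bool" where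
  "can_crash P s p \<longleftrightarrow> p \<notin> crashed s \<and>
     (case p of Srv j \<Rightarrow> j < pn P \<and> card {i. Srv i \<in> crashed s} < pf P | _ \<Rightarrow> True)"

text \<open>Messages are sent in list order; a process crashing during a step sends a prefix.\<close>
definition sent_ok :: "('v, 'c) params \<Rightarrow> ('v, 'c) gstate \<Rightarrow> proc \<Rightarrow> bool
    \<Rightarrow> (proc \<times> ('v, 'c) msg) list \<Rightarrow> (proc \<times> ('v, 'c) msg) list \<Rightarrow> bool" where
  "sent_ok P s p cr Os Os' \<longleftrightarrow> (if cr then can_crash P s p \<and> (\<exists>m. Os' = take m Os) else Os' = Os)"

definition post :: "('v, 'c) gstate \<Rightarrow> proc \<Rightarrow> ('v, 'c) pkt set \<Rightarrow> bool
    \<Rightarrow> (proc \<times> ('v, 'c) msg) list \<Rightarrow> ('v, 'c) gstate" where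
  "post s p rm cr Os' =
     s\<lparr>net := (net s - rm) \<union> (\<lambda>(d, m). (nid s, p, d, m)) ` set Os',
       nid := Suc (nid s),
       crashed := (if cr then insert p (crashed s) else crashed s)\<rparr>"

definition step :: "('v, 'c) params \<Rightarrow> ('v, 'c) gstate \<Rightarrow> ('v, 'c) action \<Rightarrow> ('v, 'c) gstate \<Rightarrow> bool" where
  "step P s a s' \<longleftrightarrow>
    (case a of
      Skip \<Rightarrow> s' = s
    | Crash p \<Rightarrow> can_crash P s p \<and> s' = s\<lparr>crashed := insert p (crashed s)\<rparr>
    | Invoke p i cr Os' \<Rightarrow> p \<notin> crashed s \<and>
        (case cli_inv P p i (cli s p) of
           None \<Rightarrow> False
         | Some (C', Os) \<Rightarrow> sent_ok P s p cr Os Os' \<and>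
             s' = (post s p {} cr Os')\<lparr>cli := (cli s)(p := C')\<rparr>)
    | Receive x eo cr Os' \<Rightarrow> x \<in> net s \<and> pkt_dst x \<notin> crashed s \<and>
        (case pkt_dst x of
           Srv j \<Rightarrow> j < pn P \<and>
             (let (L', Os, u) = srv_recv P j (pkt_src x) (pkt_msg x) eo (srv s j) in
              (u \<longrightarrow> errs s < pe P) \<and> sent_ok P s (Srv j) cr Os Os' \<and>
              s' = (post s (Srv j) {x} cr Os')\<lparr>srv := (srv s)(j := L'),
                                             errs := errs s + (if u then 1 else 0)\<rparr>)
         | p \<Rightarrow>
             (let (C', Os) = cli_recv P p (pkt_src x) (pkt_msg x) (cli s p) in
              sent_ok P s p cr Os Os' \<and>
              s' = (post s p {x} cr Os')\<lparr>cli := (cli s)(p := C')\<rparr>)))"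

definition init :: "('v, 'c) params \<Rightarrow> 'v \<Rightarrow> ('v, 'c) gstate" where
  "init P v0 = \<lparr>crashed = {}, net = {}, nid = 0, errs = 0,
     srv = (\<lambda>j. \<lparr>stag = t0, selem = pPhi P j v0, sR = {}, sH = {}, vseen = {}, mseen = {}\<rparr>),
     cli = (\<lambda>p. \<lparr>ph = Idle, cnt = 0, ret = None\<rparr>)\<rparr>"

text \<open>Well-formed (fair) execution: infinite sequence of states and actions from the initial
state, well-formedness enforced by cli_inv (invocation only when idle), and reliable
channels: every packet whose destination never crashes is eventually delivered.\<close>
definition fair_exec :: "('v, 'c) params \<Rightarrow> 'v \<Rightarrow> (nat \<Rightarrow> ('v, 'c) gstate) \<Rightarrow> (nat \<Rightarrow> ('v, 'c) action) \<Rightarrow> bool" where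
  "fair_exec P v0 ex act \<longleftrightarrow>
     ex 0 = init P v0 \<and>
     (\<forall>i. step P (ex i) (act i) (ex (Suc i))) \<and>
     (\<forall>i x. x \<in> net (ex i) \<and> (\<forall>j. pkt_dst x \<notin> crashed (ex j)) \<longrightarrow> (\<exists>j\<ge>i. x \<notin> net (ex j)))"

definition is_client :: "proc \<Rightarrow> bool" where
  "is_client p \<longleftrightarrow> (case p of Srv _ \<Rightarrow> False | _ \<Rightarrow> True)"

text \<open>Client p invokes an operation at step i (only invocations turn Idle into non-Idle).\<close>
definition invokes_at :: "(nat \<Rightarrow> ('v, 'c) gstate) \<Rightarrow> proc \<Rightarrow> nat \<Rightarrow> bool" where
  "invokes_at ex p i \<longleftrightarrow> ph (cli (ex i) p) = Idle \<and> ph (cli (ex (Suc i)) p) \<noteq> Idle"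

definition completes_after :: "(nat \<Rightarrow> ('v, 'c) gstate) \<Rightarrow> proc \<Rightarrow> nat \<Rightarrow> bool" where
  "completes_after ex p i \<longleftrightarrow> (\<exists>j>i. ph (cli (ex j) p) = Idle)"

end

theory Submission
  imports Defs
begin

text \<open>Only the number of coded elements matters for liveness, not their values; decoding plays no role.
A message relayed in full to all of the servers \<open>s\<^sub>1, \<dots>, s\<^sub>f\<^sub>+\<^sub>1\<close> reaches a correct one
among them, hence every correct server. A server that is still alive after adopting a tag has relayed it
in full, so every tag that is ever reported is eventually delivered at every correct server.
Queries are therefore answered by a majority, and writes are acknowledged by all of the at least
\<open>n - f \<ge> k\<close> correct servers.

Suppose that a read with request tag \<open>t\<^sub>r\<close> never completes. Every correct server registers it.
If one of them ever drops the registration, it has seen \<open>k + 2e = n - f\<close> READ-DISPERSE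
announcements for a common tag; an announcement is sent only after the corresponding response, so the
reader receives \<open>n - f\<close> responses with that tag and completes. If none drops it, let \<open>t\<close> be
the maximum of \<open>t\<^sub>r\<close> and of the tags stored by the correct servers when they register the read.
A correct server either stores \<open>t\<close> at registration or delivers it later while the reader is
registered, so it sends a response with tag \<open>t\<close>, and again the read completes.\<close>

subsection \<open>Server transitions\<close>

text \<open>The read quorum \<open>k + 2e\<close> equals \<open>n - f\<close>, which is all that the
  correct servers guarantee. None of them can be spared, hence the search for a tag that every
  correct server reports.

  A process crashing during a step sends only a prefix of its output, so a state change does not
  show that the messages went out. The order of the output lists helps: forwards to the relays
  precede coded elements, and a response precedes its READ-DISPERSE. What escapes from a crash thus
  carries its own evidence. Where order does not help, the claims are restricted to processes not
  yet crashed.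

  Clients ignore replies outside the matching phase, so fairness alone is not enough: a reply must
  not arrive too early. Operation counters settle this, since an acknowledgement or coded element of
  an operation exists only after its query phase has ended.

  Each phase is ended by contradiction: an invariant keeps the counted replies below the quorum
  while the phase lasts, and the correct servers alone exceed that bound.\<close>

declare split_paired_Ex [simp del] split_paired_All [simp del]

section \<open>Prefixes of output lists\<close>

lemma take_append_before:
  assumes "y \<in> set (take k (xs @ ys))" "y \<notin> set xs"
  shows "set xs \<subseteq> set (take k (xs @ ys))"
  using assms by (cases "k \<le> length xs") (auto dest: in_set_takeD)

text \<open>Messages addressed to consecutive servers leave in index order. Injectivity of
  \<open>g\<close> makes the position of \<open>g j\<close> unique, so a prefix containing it
  contains all earlier entries.\<close>

lemma take_map_upt_initial:
  assumes "g j \<in> set (take k (map g [a..<b] @ ys))" "g j \<notin> set ys" "inj g" "a \<le> i" "i \<le> j"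
  shows "g i \<in> set (take k (map g [a..<b] @ ys))"
proof -
  have "g j \<in> set (take k (map g [a..<b]))"
    using assms(1,2) by (auto dest: in_set_takeD)
  then obtain l where l: "l < k" "l < b - a" "g j = g (a + l)"
    by (auto simp: in_set_conv_nth)
  then have "j = a + l" using \<open>inj g\<close> by (simp add: inj_eq)
  then have "i - a < k" "i - a < b - a" "i = a + (i - a)" using l assms by auto
  then have "g i \<in> set (take k (map g [a..<b]))"
    by (auto simp: in_set_conv_nth intro!: exI[of _ "i - a"])
  then show ?thesis by simp
qed

text \<open>The blocks \<open>F x\<close> are a response followed by its announcements. The head of
  the block in which \<open>y\<close> occurs survives any truncation that keeps
  \<open>y\<close>.\<close>

lemma take_concat_before:
  assumes "y \<in> set (take k (concat (map F xs) @ zs))" "y \<notin> set zs"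
    and "\<And>x. y \<in> set (F x) \<Longrightarrow> x \<in> set xs \<Longrightarrow> hd (F x) \<noteq> y \<and> G (hd (F x))"
  shows "\<exists>z \<in> set (take k (concat (map F xs) @ zs)). G z"
  using assms
proof (induction xs arbitrary: k)
  case Nil
  then show ?case by (auto dest: in_set_takeD)
next
  case (Cons x xs)
  show ?case
  proof (cases "y \<in> set (take k (F x))")
    case True
    then have "y \<in> set (F x)" by (rule in_set_takeD)
    moreover have "take k (F x) \<noteq> []" using True by (metis empty_iff list.set(1))
    then have "hd (F x) \<in> set (take k (F x))" by (cases k; cases "F x"; simp)
    ultimately show ?thesis using Cons.prems(3) by auto
  next
    case False
    then have "y \<in> set (take (k - length (F x)) (concat (map F xs) @ zs))"
      using Cons.prems(1) by auto
    then show ?thesis using Cons.IH[of "k - length (F x)"] Cons.prems(2,3) by auto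
  qed
qed

lemma set_md_meta: "set (md_meta P m) = {(Srv j, MMeta m) |j. j \<le> pf P}"
  by (auto simp: md_meta_def)

definition carries_meta :: "('v, 'c) msg \<Rightarrow> meta \<Rightarrow> bool" where
  "carries_meta m mm \<longleftrightarrow> m = MMeta mm \<or> m = MMetaD mm"

lemma carries_meta_simps [simp]:
  "carries_meta (MMeta a) b \<longleftrightarrow> a = b" "carries_meta (MMetaD a) b \<longleftrightarrow> a = b"
  "\<not> carries_meta (VFull t v oc) b" "\<not> carries_meta (VCoded t c oc) b" "\<not> carries_meta (QTag oc) b"
  "\<not> carries_meta (RTag oc t) b" "\<not> carries_meta (Ack t oc) b" "\<not> carries_meta (RResp r t c) b"
  by (auto simp: carries_meta_def)

section \<open>Delivery of values and metadata at a server\<close>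

lemma value_deliver_out:
  assumes "value_deliver P s t c oc L = (L', out)"
  shows "out = concat (map (\<lambda>(r, tr). (Rd (fst r), RResp r t c) # md_meta P (ReadDisperse t s r))
      (filter (\<lambda>(r, tr). tr \<le> t) (sorted_list_of_set (sR L)))) @ [(Wr (snd t), Ack t oc)]"
  using arg_cong[OF assms, of snd] unfolding value_deliver_def Let_def by simp

lemma value_deliver_emits:
  assumes "value_deliver P s t c oc L = (L', out)" "finite (sR L)"
  shows "(Wr (snd t), Ack t oc) \<in> set out"
    "(r, tr) \<in> sR L \<Longrightarrow> tr \<le> t \<Longrightarrow> (Rd (fst r), RResp r t c) \<in> set out"
    "(d, m) \<in> set out \<Longrightarrow> m = Ack t oc \<or> (\<exists>j r. d = Srv j \<and> m = MMeta (ReadDisperse t s r)) \<or>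
       (\<exists>r tr. (r, tr) \<in> sR L \<and> d = Rd (fst r) \<and> m = RResp r t c)"
  using assms(2) unfolding value_deliver_out[OF assms(1)]
  by (auto simp: set_md_meta intro!: bexI[where x = "(r, tr)"])

lemma value_deliver_state:
  assumes "value_deliver P s t c oc L = (L', out)" "finite (sR L)"
  shows "stag L' = max (stag L) t" "sR L' = sR L" "vseen L' = vseen L" "mseen L' = mseen L"
    "sH L' = sH L \<union> (\<lambda>x. (t, s, fst x)) ` {x \<in> sR L. snd x \<le> t}"
proof -
  have *: "(\<lambda>(r, tr). (t, s, r)) = (\<lambda>x. (t, s, fst x))" "(\<lambda>(r, tr). tr \<le> t) = (\<lambda>x. snd x \<le> t)"
    by auto
  let ?L1 = "L\<lparr>sH := sH L \<union> (\<lambda>x. (t, s, fst x)) ` {x \<in> sR L. snd x \<le> t}\<rparr>"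
  have "L' = (if stag L < t then ?L1\<lparr>stag := t, selem := c\<rparr> else ?L1)"
    using assms unfolding value_deliver_def Let_def * by (cases "stag L < t") auto
  then show "stag L' = max (stag L) t" "sR L' = sR L" "vseen L' = vseen L" "mseen L' = mseen L"
    "sH L' = sH L \<union> (\<lambda>x. (t, s, fst x)) ` {x \<in> sR L. snd x \<le> t}"
    by (cases "stag L < t"; auto simp: max_def)+
qed

lemma value_deliver_frame:
  assumes "value_deliver P s t c oc L = (L', out)" "finite (sR L)"
  shows "stag L' = max (stag L) t \<and> sR L' = sR L \<and> vseen L' = vseen L \<and> mseen L' = mseen L"
  using value_deliver_state[OF assms] by blast

text \<open>In each block of the output the response comes first, so no truncation can keep the
  announcement and lose the response to the same reader.\<close>

lemma value_deliver_prefix: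
  assumes "value_deliver P s t c oc L = (L', out)" "finite (sR L)"
    and "(Srv j, MMeta mm) \<in> set (take k out)"
  shows "\<exists>r. mm = ReadDisperse t s r \<and> (Rd (fst r), RResp r t c) \<in> set (take k out)"
proof -
  let ?F = "\<lambda>(r, tr). (Rd (fst r), RResp r t c) # md_meta P (ReadDisperse t s r)"
  define regs where "regs = filter (\<lambda>(r, tr). tr \<le> t) (sorted_list_of_set (sR L))"
  have out: "out = concat (map ?F regs) @ [(Wr (snd t), Ack t oc)]"
    using value_deliver_out[OF assms(1)] unfolding regs_def .
  let ?G = "\<lambda>z. \<exists>r. mm = ReadDisperse t s r \<and> z = (Rd (fst r), RResp r t c)"
  have "\<exists>z \<in> set (take k (concat (map ?F regs) @ [(Wr (snd t), Ack t oc)])). ?G z"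
    by (rule take_concat_before[where y = "(Srv j, MMeta mm)"])
      (use assms(3) in \<open>auto simp: out set_md_meta\<close>)
  then show ?thesis unfolding out by blast
qed

lemma meta_deliver_emits:
  assumes "meta_deliver P s mm eo L = (L', out, u)" "(d, m) \<in> set out"
  shows "(\<exists>j t r. d = Srv j \<and> m = MMeta (ReadDisperse t s r)) \<or>
    (\<exists>r tr t c. mm = ReadValue r tr \<and> d = Rd (fst r) \<and> m = RResp r t c)"
  using assms by (cases mm) (auto simp: meta_deliver_def Let_def set_md_meta split: if_splits)

lemma meta_deliver_state:
  assumes "meta_deliver P s mm eo L = (L', out, u)"
  shows "stag L' = stag L" "vseen L' = vseen L" "mseen L' = mseen L"
    "sR L' \<subseteq> sR L \<union> {(r, tr). mm = ReadValue r tr}"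
  using assms by (cases mm; auto simp: meta_deliver_def Let_def unreg_def split: if_splits; fail)+

lemma meta_deliver_frame:
  assumes "meta_deliver P s mm eo L = (L', out, u)"
  shows "stag L' = stag L \<and> vseen L' = vseen L \<and> mseen L' = mseen L"
  using meta_deliver_state[OF assms] by blast

lemma meta_deliver_unregister:
  assumes "meta_deliver P s mm eo L = (L', out, u)" "(r, tr) \<in> sR L" "(r, tr) \<notin> sR L'"
  shows "(\<exists>tr'. mm = ReadComplete r tr') \<or>
       (\<exists>t x. mm = ReadDisperse t x r \<and> card {y. (t, y, r) \<in> insert (t, x, r) (sH L)} \<ge> kk P + 2 * pe P)"
  using assms by (cases mm) (auto simp: meta_deliver_def Let_def unreg_def split: if_splits)

text \<open>The middle alternative is the marker \<open>(t0, s, r)\<close> left by a READ-COMPLETE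
  that finds no registration; it has the same shape as the record of a response with tag
  \<open>t0\<close>.\<close>

lemma meta_deliver_history:
  assumes "meta_deliver P s mm eo L = (L', out, u)" "(t, x, r) \<in> sH L'" "(t, x, r) \<notin> sH L"
  shows "mm = ReadDisperse t x r \<or> (\<exists>tr. mm = ReadComplete r tr) \<or>
    x = s \<and> (\<exists>c. (Rd (fst r), RResp r t c) \<in> set out)"
  using assms by (cases mm) (auto simp: meta_deliver_def Let_def remove_r_def split: if_splits)

lemma meta_deliver_register:
  assumes "meta_deliver P s (ReadValue r tr) eo L = (L', out, u)" "(t0, s, r) \<notin> sH L"
  shows "(r, tr) \<in> sR L'" "tr \<le> stag L \<Longrightarrow> \<exists>c. (Rd (fst r), RResp r (stag L) c) \<in> set out"
  using assms by (auto simp: meta_deliver_def Let_def split: if_splits)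

lemma meta_deliver_prefix:
  assumes "meta_deliver P s mm eo L = (L', out, u)" "(Srv j, MMeta m') \<in> set (take k out)"
  shows "\<exists>t r c. m' = ReadDisperse t s r \<and> (Rd (fst r), RResp r t c) \<in> set (take k out)"
proof -
  have "out \<noteq> []" using assms(2) by auto
  then have "\<exists>r c. out = (Rd (fst r), RResp r (stag L) c) # md_meta P (ReadDisperse (stag L) s r)"
    using assms(1) unfolding meta_deliver_def Let_def
    by (cases mm) (simp_all split: if_splits, blast+)
  then obtain r c where out: "out = (Rd (fst r), RResp r (stag L) c) # md_meta P (ReadDisperse (stag L) s r)"
    by blast
  show ?thesis
  proof (cases k)
    case (Suc k')
    have "m' = ReadDisperse (stag L) s r"
      using in_set_takeD[OF assms(2)] by (auto simp: out set_md_meta)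
    then show ?thesis using Suc out by auto
  qed (use assms(2) in simp)
qed

section \<open>Receipt of one packet by a server\<close>

lemma srv_recv_cases [consumes 1, case_names query ignored full coded meta metaD]:
  assumes "srv_recv P s src m eo L = (L', Os, u)"
  obtains oc where "m = QTag oc" "L' = L" "Os = [(src, RTag oc (stag L))]"
  | "L' = L" "Os = []" "\<And>oc. m \<noteq> QTag oc" "\<And>t v oc. m = VFull t v oc \<Longrightarrow> (t, oc) \<in> vseen L"
    "\<And>t c oc. m = VCoded t c oc \<Longrightarrow> pf P < s \<Longrightarrow> (t, oc) \<in> vseen L"
    "\<And>mm. m = MMeta mm \<Longrightarrow> mm \<in> mseen L" "\<And>mm. m = MMetaD mm \<Longrightarrow> pf P < s \<Longrightarrow> mm \<in> mseen L"
  | t v oc out where "m = VFull t v oc" "(t, oc) \<notin> vseen L"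
    "value_deliver P s t (pPhi P s v) oc (L\<lparr>vseen := insert (t, oc) (vseen L)\<rparr>) = (L', out)"
    "Os = map (\<lambda>j. (Srv j, VFull t v oc)) [Suc s..<pf P + 1]
          @ map (\<lambda>j. (Srv j, VCoded t (pPhi P j v) oc)) (filter (\<lambda>j. j \<noteq> s) [0..<pn P]) @ out"
  | t c oc where "m = VCoded t c oc" "(t, oc) \<notin> vseen L" "pf P < s"
    "value_deliver P s t c oc (L\<lparr>vseen := insert (t, oc) (vseen L)\<rparr>) = (L', Os)"
  | mm out where "m = MMeta mm" "mm \<notin> mseen L"
    "meta_deliver P s mm eo (L\<lparr>mseen := insert mm (mseen L)\<rparr>) = (L', out, u)"
    "Os = map (\<lambda>j. (Srv j, MMeta mm)) [Suc s..<pf P + 1]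
          @ map (\<lambda>j. (Srv j, MMetaD mm)) (filter (\<lambda>j. j \<noteq> s) [0..<pn P]) @ out"
  | mm where "m = MMetaD mm" "mm \<notin> mseen L" "pf P < s"
    "meta_deliver P s mm eo (L\<lparr>mseen := insert mm (mseen L)\<rparr>) = (L', Os, u)"
proof (cases m)
  case (VFull t v oc)
  show ?thesis
    using assms that(2)
      that(3)[OF VFull, of "snd (value_deliver P s t (pPhi P s v) oc (L\<lparr>vseen := insert (t, oc) (vseen L)\<rparr>))"]
    by (simp add: VFull srv_recv_def Let_def split: if_splits prod.splits)
next
  case (VCoded t c oc)
  then show ?thesis
    using assms that(2) that(4)[OF VCoded]
    by (cases "pf P < s"; simp add: srv_recv_def Let_def split: if_splits prod.splits)
next
  case (MMeta mm)
  show ?thesis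
    using assms that(2)
      that(5)[OF MMeta, of "fst (snd (meta_deliver P s mm eo (L\<lparr>mseen := insert mm (mseen L)\<rparr>)))"]
    by (simp add: MMeta srv_recv_def Let_def split: if_splits prod.splits)
next
  case (MMetaD mm)
  then show ?thesis
    using assms that(2) that(6)[OF MMetaD]
    by (cases "pf P < s"; simp add: srv_recv_def Let_def split: if_splits prod.splits)
qed (use assms that(1,2) in \<open>auto simp: srv_recv_def Let_def\<close>)

lemma srv_recv_state:
  assumes "srv_recv P s src m eo L = (L', Os, u)" "finite (sR L)"
  shows "stag L \<le> stag L'" "finite (sR L')" "vseen L \<subseteq> vseen L'" "mseen L \<subseteq> mseen L'"
    "sR L' \<subseteq> sR L \<union> {(r, tr). ReadValue r tr \<in> mseen L'}"
    "mm \<in> mseen L' \<Longrightarrow> mm \<notin> mseen L \<Longrightarrow> carries_meta m mm"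
    "stag L' \<noteq> stag L \<Longrightarrow> \<exists>oc. (stag L', oc) \<in> vseen L'"
    "(t, oc) \<in> vseen L' \<Longrightarrow> (t, oc) \<notin> vseen L \<Longrightarrow> t \<le> stag L'"
proof -
  \<comment> \<open>One message registers at most one pair, so a single step keeps the registrations
    finite.\<close>
  have fin: "finite A" if "A \<subseteq> sR L \<union> {(r, tr). mm = ReadValue r tr}" for A mm
  proof (rule finite_subset[OF that])
    have "{(r, tr). mm = ReadValue r tr} \<subseteq> {case mm of ReadValue r tr \<Rightarrow> (r, tr)}"
      by auto
    then show "finite (sR L \<union> {(r, tr). mm = ReadValue r tr})"
      using assms(2) finite_subset by blast
  qed
  note v = value_deliver_frame
  note md = meta_deliver_state and m = meta_deliver_frame
  show "stag L \<le> stag L'"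
    using assms(1) by (cases rule: srv_recv_cases) (use assms(2) in \<open>auto dest!: v m\<close>)
  show "finite (sR L')"
    using assms(1)
  proof (cases rule: srv_recv_cases)
    case (meta mm out) then show ?thesis using md(4)[OF meta(3)] by (intro fin[of _ mm]) simp
  next
    case (metaD mm) then show ?thesis using md(4)[OF metaD(4)] by (intro fin[of _ mm]) simp
  qed (use assms(2) in \<open>auto dest!: v\<close>)
  show "vseen L \<subseteq> vseen L'" "mseen L \<subseteq> mseen L'"
    using assms(1) by (cases rule: srv_recv_cases; use assms(2) in \<open>auto dest!: v m\<close>)+
  show "sR L' \<subseteq> sR L \<union> {(r, tr). ReadValue r tr \<in> mseen L'}"
    using assms(1)
  proof (cases rule: srv_recv_cases)
    case (meta mm out) then show ?thesis using md(3,4)[OF meta(3)] by auto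
  next
    case (metaD mm) then show ?thesis using md(3,4)[OF metaD(4)] by auto
  qed (use assms(2) in \<open>auto dest!: v\<close>)
  show "mm \<in> mseen L' \<Longrightarrow> mm \<notin> mseen L \<Longrightarrow> carries_meta m mm"
    using assms(1) by (cases rule: srv_recv_cases) (use assms(2) in \<open>auto dest!: v m\<close>)
  show "stag L' \<noteq> stag L \<Longrightarrow> \<exists>oc. (stag L', oc) \<in> vseen L'"
    using assms(1)
    by (cases rule: srv_recv_cases) (use assms(2) in \<open>auto dest!: v m simp: max_def split: if_splits\<close>)
  show "(t, oc) \<in> vseen L' \<Longrightarrow> (t, oc) \<notin> vseen L \<Longrightarrow> t \<le> stag L'"
    using assms(1)
    by (cases rule: srv_recv_cases) (use assms(2) in \<open>auto dest!: v m\<close>)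
qed

text \<open>Duplicates are included: they change nothing, but the identifier was recorded at the
  first receipt. Coded and relayed forms need \<open>pf P < s\<close> because the relays ignore
  them.\<close>

lemma srv_recv_seen:
  assumes "srv_recv P s src m eo L = (L', Os, u)" "finite (sR L)"
  shows "m = VFull t v oc \<Longrightarrow> (t, oc) \<in> vseen L'" "m = VCoded t c oc \<Longrightarrow> pf P < s \<Longrightarrow> (t, oc) \<in> vseen L'"
    "m = MMeta mm \<Longrightarrow> mm \<in> mseen L'" "m = MMetaD mm \<Longrightarrow> pf P < s \<Longrightarrow> mm \<in> mseen L'"
  using assms(1) by (cases rule: srv_recv_cases;
    use assms(2) in \<open>auto dest!: value_deliver_frame meta_deliver_frame\<close>)+

text \<open>A newly recorded identifier reveals the kind of message received. \<open>Os\<close> is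
  the intended output, so these forwards are certain only if the server survives the step.\<close>

lemma srv_recv_full_forward:
  assumes "srv_recv P s src m eo L = (L', Os, u)" "finite (sR L)"
    and "(t, oc) \<in> vseen L'" "(t, oc) \<notin> vseen L"
  obtains v where "m = VFull t v oc" "\<And>j. s < j \<Longrightarrow> j \<le> pf P \<Longrightarrow> (Srv j, VFull t v oc) \<in> set Os"
    "\<And>j. j < pn P \<Longrightarrow> j \<noteq> s \<Longrightarrow> (Srv j, VCoded t (pPhi P j v) oc) \<in> set Os"
  | c where "m = VCoded t c oc" "pf P < s"
  using assms(1)
proof (cases rule: srv_recv_cases)
  case (full t' v oc' out)
  then have "t' = t \<and> oc' = oc" using assms(2-4) value_deliver_state(3)[OF full(3)] by auto
  then show thesis using full by (intro that(1)[of v]) auto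
next
  case (coded t' c oc')
  then have "t' = t \<and> oc' = oc" using assms(2-4) value_deliver_state(3)[OF coded(4)] by auto
  then show thesis using coded by (intro that(2)[of c]) auto
qed (use assms(3,4) in \<open>auto dest!: meta_deliver_frame\<close>)

lemma srv_recv_value_emits:
  assumes "srv_recv P s src m eo L = (L', Os, u)" "finite (sR L)"
    and "(t, oc) \<in> vseen L'" "(t, oc) \<notin> vseen L"
  shows "(Wr (snd t), Ack t oc) \<in> set Os"
    "(r, tr) \<in> sR L \<Longrightarrow> tr \<le> t \<Longrightarrow> \<exists>c. (Rd (fst r), RResp r t c) \<in> set Os"
proof -
  have "(Wr (snd t), Ack t oc) \<in> set Os \<and>
      ((r, tr) \<in> sR L \<longrightarrow> tr \<le> t \<longrightarrow> (\<exists>c. (Rd (fst r), RResp r t c) \<in> set Os))"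
    using assms(1)
  proof (cases rule: srv_recv_cases)
    case (full t' v oc' out)
    then have "t' = t \<and> oc' = oc" using assms(2-4) value_deliver_state(3)[OF full(3)] by auto
    moreover have "set out \<subseteq> set Os" using full(4) by auto
    moreover have "finite (sR (L\<lparr>vseen := insert (t', oc') (vseen L)\<rparr>))" using assms(2) by simp
    note value_deliver_emits(1)[OF full(3) this] value_deliver_emits(2)[OF full(3) this, of r tr]
    ultimately show ?thesis by simp blast
  next
    case (coded t' c oc')
    then have "t' = t \<and> oc' = oc" using assms(2-4) value_deliver_state(3)[OF coded(4)] by auto
    then show ?thesis
      using value_deliver_emits(1)[OF coded(4)] value_deliver_emits(2)[OF coded(4), of r tr] assms(2)
      by simp blast
  qed (use assms(3,4) in \<open>auto dest!: meta_deliver_frame\<close>)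
  then show "(Wr (snd t), Ack t oc) \<in> set Os"
    "(r, tr) \<in> sR L \<Longrightarrow> tr \<le> t \<Longrightarrow> \<exists>c. (Rd (fst r), RResp r t c) \<in> set Os"
    by auto
qed

lemma srv_recv_meta_forward:
  assumes "srv_recv P s src m eo L = (L', Os, u)" "finite (sR L)"
    and "mm \<in> mseen L'" "mm \<notin> mseen L" "s \<le> pf P" "j < pn P" "j \<noteq> s"
  shows "(Srv j, MMetaD mm) \<in> set Os"
  using assms(1)
proof (cases rule: srv_recv_cases)
  case (meta mm' out)
  then have "mm' = mm" using assms(2-4) meta_deliver_state(3)[OF meta(3)] by auto
  then show ?thesis using meta assms(6,7) by auto
qed (use assms in \<open>auto dest!: value_deliver_frame meta_deliver_frame\<close>)

text \<open>The condition on \<open>sH\<close> excludes the branch where an early READ-COMPLETE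
  cancels the registration. The last two conclusions keep registration and value delivery in
  separate steps, so a tag unseen before registration is still unseen right after it.\<close>

lemma srv_recv_register:
  assumes "srv_recv P s src m eo L = (L', Os, u)" "finite (sR L)"
    and "ReadValue r tr \<in> mseen L'" "ReadValue r tr \<notin> mseen L" "(t0, s, r) \<notin> sH L"
  shows "(r, tr) \<in> sR L'" "tr \<le> stag L \<Longrightarrow> \<exists>c. (Rd (fst r), RResp r (stag L) c) \<in> set Os"
    "vseen L' = vseen L" "stag L' = stag L"
proof -
  have "(r, tr) \<in> sR L' \<and> (tr \<le> stag L \<longrightarrow> (\<exists>c. (Rd (fst r), RResp r (stag L) c) \<in> set Os)) \<and>
      vseen L' = vseen L \<and> stag L' = stag L"
    using assms(1)
  proof (cases rule: srv_recv_cases)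
    case (meta mm' out)
    then have "mm' = ReadValue r tr" using assms(2-4) meta_deliver_state(3)[OF meta(3)] by auto
    then show ?thesis
      using meta meta_deliver_register[of P s r tr] meta_deliver_state(1,2)[OF meta(3)] assms(5)
      by fastforce
  next
    case (metaD mm')
    then have "mm' = ReadValue r tr" using assms(2-4) meta_deliver_state(3)[OF metaD(4)] by auto
    then show ?thesis
      using metaD meta_deliver_register[of P s r tr] meta_deliver_state(1,2)[OF metaD(4)] assms(5)
      by fastforce
  qed (use assms in \<open>auto dest!: value_deliver_frame\<close>)
  then show "(r, tr) \<in> sR L'" "tr \<le> stag L \<Longrightarrow> \<exists>c. (Rd (fst r), RResp r (stag L) c) \<in> set Os"
    "vseen L' = vseen L" "stag L' = stag L" by auto
qed

lemma srv_recv_unregister: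
  assumes "srv_recv P s src m eo L = (L', Os, u)" "finite (sR L)"
    and "(r, tr) \<in> sR L" "(r, tr) \<notin> sR L'"
  shows "(\<exists>tr'. carries_meta m (ReadComplete r tr')) \<or>
       (\<exists>t x. carries_meta m (ReadDisperse t x r) \<and>
          card {y. (t, y, r) \<in> insert (t, x, r) (sH L)} \<ge> kk P + 2 * pe P)"
  using assms(1)
proof (cases rule: srv_recv_cases)
  case (meta mm' out)
  then show ?thesis using meta_deliver_unregister[OF meta(3)] assms(3,4) by simp
next
  case (metaD mm')
  then show ?thesis using meta_deliver_unregister[OF metaD(4)] assms(3,4) by simp
qed (use assms in \<open>auto dest!: value_deliver_frame\<close>)

lemma srv_recv_history:
  assumes "srv_recv P s src m eo L = (L', Os, u)" "finite (sR L)"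
    and "(t, x, r) \<in> sH L'" "(t, x, r) \<notin> sH L"
  shows "carries_meta m (ReadDisperse t x r) \<or> (\<exists>tr. carries_meta m (ReadComplete r tr)) \<or>
    x = s \<and> (\<exists>c. (Rd (fst r), RResp r t c) \<in> set Os)"
  using assms(1)
proof (cases rule: srv_recv_cases)
  case (full t' v oc out)
  with assms(2-4) value_deliver_state(5)[OF full(3)]
  obtain tr where "t' = t" "x = s" "(r, tr) \<in> sR L" "tr \<le> t" by force
  moreover have "set out \<subseteq> set Os" using full(4) by auto
  moreover have "finite (sR (L\<lparr>vseen := insert (t', oc) (vseen L)\<rparr>))" using assms(2) by simp
  note value_deliver_emits(2)[OF full(3) this, of r tr]
  ultimately show ?thesis by simp blast
next
  case (coded t' c oc)
  with assms(2-4) value_deliver_state(5)[OF coded(4)]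
  obtain tr where "t' = t" "x = s" "(r, tr) \<in> sR L" "tr \<le> t" by force
  then show ?thesis
    using value_deliver_emits(2)[OF coded(4), of r tr] assms(2) by simp blast
next
  case (meta mm' out)
  then show ?thesis using meta_deliver_history[OF meta(3) assms(3)] assms(4) by auto
next
  case (metaD mm')
  then show ?thesis using meta_deliver_history[OF metaD(4) assms(3)] assms(4) by auto
qed (use assms in auto)

lemma srv_recv_sends_tag:
  assumes "srv_recv P s src m eo L = (L', Os, u)" "finite (sR L)" "(d, RTag oc t) \<in> set Os"
  shows "t = stag L'" "L' = L"
  using assms(1) by (cases rule: srv_recv_cases;
    use assms(2,3) in \<open>auto dest!: value_deliver_emits(3) meta_deliver_emits\<close>)+

text \<open>Stated for a prefix because the sender may crash. Forwards leave in increasing order, so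
  reaching relay \<open>j\<close> means having served every relay between \<open>s\<close> and
  \<open>j\<close>.\<close>

lemma srv_recv_sends_full:
  fixes P :: "('v, 'c) params"
  assumes "srv_recv P s src m eo L = (L', Os, u)" "finite (sR L)" "(d, VFull t v oc) \<in> set (take k Os)"
  obtains j where "m = VFull t v oc" "d = Srv j" "s < j" "j \<le> pf P"
    "\<And>j'. s < j' \<Longrightarrow> j' \<le> j \<Longrightarrow> (Srv j', VFull t v oc) \<in> set (take k Os)"
proof -
  have mem: "(d, VFull t v oc) \<in> set Os" using assms(3) by (rule in_set_takeD)
  from assms(1) show thesis
  proof (cases rule: srv_recv_cases)
    case (full t' v' oc' out)
    define g where "g = (\<lambda>j. (Srv j :: proc, VFull t v oc :: ('v, 'c) msg))"
    define ys where "ys = map (\<lambda>j. (Srv j, VCoded t' (pPhi P j v') oc')) (filter (\<lambda>j. j \<noteq> s) [0..<pn P]) @ out"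
    have no: "(d', VFull t v oc) \<notin> set ys" for d'
      using value_deliver_emits(3)[OF full(3), of d'] assms(2) by (auto simp: ys_def)
    with mem full(4) obtain j where j: "t' = t" "v' = v" "oc' = oc" "d = Srv j" "s < j" "j \<le> pf P"
      unfolding ys_def by auto
    have Os: "Os = map g [Suc s..<pf P + 1] @ ys"
      using full(4) j by (simp add: g_def ys_def)
    have "g j' \<in> set (take k Os)" if "s < j'" "j' \<le> j" for j'
      unfolding Os by (rule take_map_upt_initial[where j = j])
        (use that no assms(3) j in \<open>auto simp: g_def Os inj_def\<close>)
    then show ?thesis using full j by (intro that) (auto simp: g_def)
  qed (use assms(2) mem in \<open>auto dest!: value_deliver_emits(3) meta_deliver_emits\<close>)
qed

text \<open>All forwards of the full value precede the first coded element, so even one coded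
  element that escapes a crash certifies the whole forwarding.\<close>

lemma srv_recv_sends_coded:
  fixes P :: "('v, 'c) params"
  assumes "srv_recv P s src m eo L = (L', Os, u)" "finite (sR L)" "(d, VCoded t c oc) \<in> set (take k Os)"
  obtains v where "m = VFull t v oc"
    "\<And>j'. s < j' \<Longrightarrow> j' \<le> pf P \<Longrightarrow> (Srv j', VFull t v oc) \<in> set (take k Os)"
proof -
  have mem: "(d, VCoded t c oc) \<in> set Os" using assms(3) by (rule in_set_takeD)
  from assms(1) show thesis
  proof (cases rule: srv_recv_cases)
    case (full t' v' oc' out)
    define xs :: "(proc \<times> ('v, 'c) msg) list"
      where "xs = map (\<lambda>j. (Srv j, VFull t' v' oc')) [Suc s..<pf P + 1]"
    have "(d, VCoded t c oc) \<notin> set out"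
      using value_deliver_emits(3)[OF full(3), of d] assms(2) by auto
    with mem full(4) have eq: "t' = t" "oc' = oc" by auto
    have "set xs \<subseteq> set (take k Os)"
      using assms(3) unfolding full(4) xs_def by (intro take_append_before[where y = "(d, VCoded t c oc)"]) auto
    moreover have "(Srv j, VFull t v' oc) \<in> set xs" if "s < j" "j \<le> pf P" for j
      using that eq by (auto simp: xs_def simp del: upt_Suc)
    ultimately show ?thesis using full(1) eq by (intro that[of v']) auto
  qed (use assms(2) mem in \<open>auto dest!: value_deliver_emits(3) meta_deliver_emits\<close>)
qed

lemma srv_recv_sends_resp:
  assumes "srv_recv P s src m eo L = (L', Os, u)" "finite (sR L)" "(d, RResp r t c) \<in> set Os"
  shows "\<exists>tr. (r, tr) \<in> sR L \<or> ReadValue r tr \<in> mseen L'"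
  using assms(1)
proof (cases rule: srv_recv_cases)
  case (full t' v oc out)
  then have "(d, RResp r t c) \<in> set out" using assms(3) by auto
  then show ?thesis using value_deliver_emits(3)[OF full(3)] assms(2) by auto
next
  case (coded t' v oc)
  then show ?thesis using value_deliver_emits(3)[OF coded(4)] assms(2,3) by auto
next
  case (meta mm' out)
  then have "(d, RResp r t c) \<in> set out" using assms(3) by auto
  then show ?thesis using meta_deliver_emits[OF meta(3)] meta_deliver_state(3)[OF meta(3)] by simp blast
next
  case (metaD mm')
  then show ?thesis using meta_deliver_emits[OF metaD(4) assms(3)] meta_deliver_state(3)[OF metaD(4)] by simp blast
qed (use assms in auto)

text \<open>A crashing server sends a prefix of its output list, so whatever part of a READ-DISPERSE it
manages to send is preceded by the response that it announces.\<close>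

lemma srv_recv_sends_meta:
  assumes "srv_recv P s src m eo L = (L', Os, u)" "finite (sR L)" "(d, m') \<in> set (take k Os)"
    and "carries_meta m' mm" "\<not> carries_meta m mm"
  obtains t r c where "mm = ReadDisperse t s r" "(Rd (fst r), RResp r t c) \<in> set (take k Os)"
proof -
  note found = that
  have mm: "m' = MMeta mm \<or> m' = MMetaD mm" using assms(4) by (simp add: carries_meta_def)
  have of_value: thesis if vd: "value_deliver P s t c oc L1 = (L', out)" "finite (sR L1)"
    and out: "(d, m') \<in> set (take k' out)" "set (take k' out) \<subseteq> set (take k Os)" for t c oc L1 k' out
  proof -
    obtain j where "d = Srv j" "m' = MMeta mm"
      using value_deliver_emits(3)[OF vd in_set_takeD[OF out(1)]] mm by auto
    then have "(Srv j, MMeta mm) \<in> set (take k' out)" using out(1) by simp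
    from value_deliver_prefix[OF vd this] obtain r where r: "mm = ReadDisperse t s r"
      "(Rd (fst r), RResp r t c) \<in> set (take k' out)" by blast
    show thesis by (rule found[OF r(1) subsetD[OF out(2) r(2)]])
  qed
  have of_meta: thesis if md: "meta_deliver P s mm' eo L1 = (L', out, u)"
    and out: "(d, m') \<in> set (take k' out)" "set (take k' out) \<subseteq> set (take k Os)" for mm' L1 k' out
  proof -
    obtain j where "d = Srv j" "m' = MMeta mm"
      using meta_deliver_emits[OF md in_set_takeD[OF out(1)]] mm by auto
    then have "(Srv j, MMeta mm) \<in> set (take k' out)" using out(1) by simp
    from meta_deliver_prefix[OF md this] obtain t r c where r: "mm = ReadDisperse t s r"
      "(Rd (fst r), RResp r t c) \<in> set (take k' out)" by blast
    show thesis by (rule found[OF r(1) subsetD[OF out(2) r(2)]])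
  qed
  show thesis
    using assms(1)
  proof (cases rule: srv_recv_cases)
    case (full t v oc out)
    \<comment> \<open>\<open>l\<close> is the length of the forwarding block. Full values and coded
      elements carry no metadata, so the message must stem from the delivery part.\<close>
    define l where "l = length Os - length out"
    have Os: "set (take k Os) = set (take k (take l Os)) \<union> set (take (k - l) out)"
      unfolding full(4) l_def by (auto simp: diff_diff_left)
    have "(d, m') \<notin> set (take l Os)"
      using mm unfolding full(4) l_def by auto
    then show thesis
      using assms(2,3) by (intro of_value[OF full(3), of "k - l"]) (auto simp: Os simp del: take_take dest: in_set_takeD)
  next
    case (coded t c oc)
    then show thesis using assms(2,3) by (intro of_value[OF coded(4), of k]) auto
  next
    case (meta mm' out)
    \<comment> \<open>Here the forwarding block relays \<open>mm'\<close>, which differs from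
      \<open>mm\<close> because the received message does not carry \<open>mm\<close>.\<close>
    define l where "l = length Os - length out"
    have Os: "set (take k Os) = set (take k (take l Os)) \<union> set (take (k - l) out)"
      unfolding meta(4) l_def by (auto simp: diff_diff_left)
    have "(d, m') \<notin> set (take l Os)"
      using mm assms(5) meta(1) unfolding meta(4) l_def by auto
    then show thesis
      using assms(2,3) by (intro of_meta[OF meta(3), of "k - l"]) (auto simp: Os simp del: take_take dest: in_set_takeD)
  next
    case (metaD mm')
    then show thesis using assms(2,3) by (intro of_meta[OF metaD(4), of k]) auto
  qed (use in_set_takeD[OF assms(3)] mm in auto)
qed

subsection \<open>Client transitions\<close>

lemma cli_recv_cases [consumes 1, case_names same wquery wsend rquery rsend ack wdone resp rdone]:
  assumes "cli_recv P p src m C = (C', Os)"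
  obtains "C' = C" "Os = []"
  | oc v S tm j t where "ph C = WQuery oc v S tm" "src = Srv j" "m = RTag oc t"
    "2 * card (insert j S) \<le> pn P" "C' = C\<lparr>ph := WQuery oc v (insert j S) (max tm t)\<rparr>" "Os = []"
  | oc v S tm j t w tw where "ph C = WQuery oc v S tm" "src = Srv j" "m = RTag oc t" "p = Wr w"
    "tw = (fst (max tm t) + 1, w)" "C' = C\<lparr>ph := WWait oc tw {}\<rparr>"
    "Os = map (\<lambda>i. (Srv i, VFull tw v oc)) [0..<pf P + 1]"
  | oc S tm j t where "ph C = RQuery oc S tm" "src = Srv j" "m = RTag oc t"
    "2 * card (insert j S) \<le> pn P" "C' = C\<lparr>ph := RQuery oc (insert j S) (max tm t)\<rparr>" "Os = []"
  | oc S tm j t r where "ph C = RQuery oc S tm" "src = Srv j" "m = RTag oc t" "p = Rd r"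
    "C' = C\<lparr>ph := RWait oc (max tm t) (\<lambda>_ _. None)\<rparr>" "Os = md_meta P (ReadValue (r, oc) (max tm t))"
  | oc tw A j where "ph C = WWait oc tw A" "card (insert j A) < kk P"
    "C' = C\<lparr>ph := WWait oc tw (insert j A)\<rparr>" "Os = []"
  | oc tw A where "ph C = WWait oc tw A" "C' = C\<lparr>ph := Idle\<rparr>" "Os = []"
  | oc tr M M' j t c where "ph C = RWait oc tr M" "M' = M(j := (M j)(t := Some c))"
    "card {i. M' i t \<noteq> None} < kk P + 2 * pe P" "C' = C\<lparr>ph := RWait oc tr M'\<rparr>" "Os = []"
  | oc tr M r v where "ph C = RWait oc tr M" "p = Rd r" "C' = C\<lparr>ph := Idle, ret := v\<rparr>"
    "Os = md_meta P (ReadComplete (r, oc) tr)"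
proof (cases src)
  case (Srv j)
  show thesis
  proof (cases "ph C")
    case Idle
    then show thesis using assms Srv that(1) by (auto simp: cli_recv_def split: msg.splits)
  next
    case (WQuery oc v S tm)
    show thesis
    proof (cases "\<exists>t. m = RTag oc t \<and> j \<notin> S")
      case True
      then obtain t where t: "m = RTag oc t" "j \<notin> S" by blast
      show thesis
      proof (cases p)
        case (Wr w)
        then show thesis using assms Srv WQuery t that(2)[OF WQuery Srv t(1)] that(3)[OF WQuery Srv t(1) Wr refl]
          by (auto simp: cli_recv_def Let_def split: if_splits)
      qed (use assms Srv WQuery t that(1) that(2)[OF WQuery Srv t(1)] in
          \<open>auto simp: cli_recv_def Let_def split: if_splits\<close>)
    qed (use assms Srv WQuery that(1) in \<open>auto simp: cli_recv_def split: msg.splits if_splits\<close>)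
  next
    case (RQuery oc S tm)
    show thesis
    proof (cases "\<exists>t. m = RTag oc t \<and> j \<notin> S")
      case True
      then obtain t where t: "m = RTag oc t" "j \<notin> S" by blast
      show thesis
      proof (cases p)
        case (Rd r)
        then show thesis using assms Srv RQuery t that(4)[OF RQuery Srv t(1)] that(5)[OF RQuery Srv t(1) Rd]
          by (auto simp: cli_recv_def Let_def split: if_splits)
      qed (use assms Srv RQuery t that(1) that(4)[OF RQuery Srv t(1)] in
          \<open>auto simp: cli_recv_def Let_def split: if_splits\<close>)
    qed (use assms Srv RQuery that(1) in \<open>auto simp: cli_recv_def split: msg.splits if_splits\<close>)
  next
    case (WWait oc tw A)
    then show thesis using assms Srv that(1) that(6)[OF WWait] that(7)[OF WWait]
      by (auto simp: cli_recv_def Let_def not_le split: msg.splits if_splits)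
  next
    case (RWait oc tr M)
    show thesis
    proof (cases p)
      case (Rd r)
      show thesis
      proof (cases "\<exists>t c. m = RResp (r, oc) t c \<and> M j t = None")
        case True
        then obtain t c where t: "m = RResp (r, oc) t c" "M j t = None" by blast
        define M' where "M' = M(j := (M j)(t := Some c))"
        show thesis
          using assms that(8)[OF RWait M'_def] that(9)[OF RWait Rd]
          by (cases "kk P + 2 * pe P \<le> card {i. M' i t \<noteq> None}")
            (auto simp: cli_recv_def Srv RWait Rd t Let_def not_le simp flip: M'_def)
      next
        case False
        then have "cli_recv P p src m C = (C, [])"
          by (auto simp: cli_recv_def Srv RWait Rd split: msg.splits)
        then show thesis using assms that(1) by simp
      qed
    qed (use assms Srv RWait that(1) in \<open>auto simp: cli_recv_def split: msg.splits\<close>)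
  qed
next
  case (Wr w)
  then have "cli_recv P p src m C = (C, [])" by (simp add: cli_recv_def)
  then show thesis using assms that(1) by simp
next
  case (Rd r)
  then have "cli_recv P p src m C = (C, [])" by (simp add: cli_recv_def)
  then show thesis using assms that(1) by simp
qed

text \<open>A reply that does not end the query leaves its sender counted, whether it was counted
  now or by an earlier reply. A query that never ends thus counts every server that answers.\<close>

lemma cli_recv_tag:
  assumes "cli_recv P p (Srv j) (RTag oc t) C = (C', Os)"
  shows "ph C = WQuery oc v S tm \<Longrightarrow> p = Wr w \<Longrightarrow> ph C' = WQuery oc' v' S' tm' \<Longrightarrow> j \<in> S'"
    "ph C = RQuery oc S tm \<Longrightarrow> p = Rd r \<Longrightarrow> ph C' = RQuery oc' S' tm' \<Longrightarrow> j \<in> S'"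
  using assms by (auto simp: cli_recv_def Let_def split: if_splits)

lemma cli_recv_ack:
  assumes "cli_recv P p (Srv j) (Ack tw oc) C = (C', Os)" "ph C = WWait oc tw A" "ph C' = WWait oc' tw' A'"
  shows "j \<in> A'"
  using assms by (auto simp: cli_recv_def Let_def split: if_splits)

lemma cli_recv_resp:
  assumes "cli_recv P (Rd r) (Srv j) (RResp (r, oc) t c) C = (C', Os)" "ph C = RWait oc tr M"
    "ph C' = RWait oc' tr' M'"
  shows "M' j t \<noteq> None"
  using assms by (auto simp: cli_recv_def Let_def split: if_splits)

lemma cli_inv_cases:
  assumes "cli_inv P p inp C = Some (C', Os)"
  obtains w v where "p = Wr w" "ph C = Idle" "cnt C' = Suc (cnt C)" "ph C' = WQuery (Suc (cnt C)) v {} t0"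
    "Os = map (\<lambda>j. (Srv j, QTag (Suc (cnt C)))) [0..<pn P]"
  | r where "p = Rd r" "ph C = Idle" "cnt C' = Suc (cnt C)" "ph C' = RQuery (Suc (cnt C)) {} t0"
    "Os = map (\<lambda>j. (Srv j, QTag (Suc (cnt C)))) [0..<pn P]"
proof -
  have "ph C = Idle" using assms by (auto simp: cli_inv_def split: if_splits)
  then show thesis using assms that
    by (cases p; cases inp) (auto simp: cli_inv_def Let_def)
qed
subsection \<open>Executions\<close>

lemma finite_eventually_all:
  assumes "finite A" "\<And>s. s \<in> A \<Longrightarrow> \<exists>N::nat. \<forall>k\<ge>N. Q s k"
  shows "\<exists>N. \<forall>k\<ge>N. \<forall>s\<in>A. Q s k"
  using assms
proof (induction A rule: finite_induct)
  case (insert x A)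
  then obtain N N' where "\<forall>k\<ge>N. Q x k" "\<forall>k\<ge>N'. \<forall>s\<in>A. Q s k" by blast
  then show ?case by (intro exI[of _ "max N N'"]) simp
qed simp

locale soda_execution =
  fixes P :: "('v, 'c) params" and v0 :: 'v
    and ex :: "nat \<Rightarrow> ('v, 'c) gstate" and act :: "nat \<Rightarrow> ('v, 'c) action"
  assumes kk_pos: "1 \<le> kk P" and majority: "2 * pf P + 1 \<le> pn P"
    and fair: "fair_exec P v0 ex act"
begin

text \<open>\<open>Os\<close> is the intended output of step \<open>i\<close> and \<open>Os'\<close> the messages actually sent.\<close>

definition sends :: "nat \<Rightarrow> proc \<Rightarrow> (proc \<times> ('v, 'c) msg) list \<Rightarrow> (proc \<times> ('v, 'c) msg) list \<Rightarrow> bool" where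
  "sends i p Os Os' \<longleftrightarrow> (\<exists>k. Os' = take k Os) \<and> (p \<notin> crashed (ex (Suc i)) \<longrightarrow> Os' = Os)"

definition packets :: "nat \<Rightarrow> proc \<Rightarrow> (proc \<times> ('v, 'c) msg) list \<Rightarrow> ('v, 'c) pkt set" where
  "packets i p Os = (\<lambda>(d, m). (nid (ex i), p, d, m)) ` set Os"

lemma ex_0: "ex 0 = init P v0"
  and step: "step P (ex i) (act i) (ex (Suc i))"
  and fair_delivery: "x \<in> net (ex i) \<Longrightarrow> \<forall>j. pkt_dst x \<notin> crashed (ex j) \<Longrightarrow> \<exists>j\<ge>i. x \<notin> net (ex j)"
  using fair by (auto simp: fair_exec_def)

lemma sent_ok_sends:
  assumes "sent_ok P (ex i) p cr Os Os'" "crashed (ex (Suc i)) = (if cr then insert p (crashed (ex i)) else crashed (ex i))"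
  shows "sends i p Os Os'"
  using assms by (auto simp: sent_ok_def sends_def split: if_splits intro: exI[of _ "length Os"])

lemma step_cases [consumes 0, case_names quiet invoke server client]:
  obtains "net (ex (Suc i)) = net (ex i)" "srv (ex (Suc i)) = srv (ex i)" "cli (ex (Suc i)) = cli (ex i)"
  | p inp C' Os Os' where "cli_inv P p inp (cli (ex i) p) = Some (C', Os)" "sends i p Os Os'"
    "net (ex (Suc i)) = net (ex i) \<union> packets i p Os'"
    "srv (ex (Suc i)) = srv (ex i)" "cli (ex (Suc i)) = (cli (ex i))(p := C')"
  | k src j m eo L' Os u Os' where "(k, src, Srv j, m) \<in> net (ex i)" "j < pn P"
    "srv_recv P j src m eo (srv (ex i) j) = (L', Os, u)" "sends i (Srv j) Os Os'" "Srv j \<notin> crashed (ex i)"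
    "net (ex (Suc i)) = net (ex i) - {(k, src, Srv j, m)} \<union> packets i (Srv j) Os'"
    "srv (ex (Suc i)) = (srv (ex i))(j := L')" "cli (ex (Suc i)) = cli (ex i)"
  | k src p m C' Os Os' where "(k, src, p, m) \<in> net (ex i)" "is_client p"
    "cli_recv P p src m (cli (ex i) p) = (C', Os)" "sends i p Os Os'"
    "net (ex (Suc i)) = net (ex i) - {(k, src, p, m)} \<union> packets i p Os'"
    "srv (ex (Suc i)) = srv (ex i)" "cli (ex (Suc i)) = (cli (ex i))(p := C')"
proof (cases "act i")
  case (Invoke p inp cr Os')
  then obtain C' Os where inv: "cli_inv P p inp (cli (ex i) p) = Some (C', Os)"
    "sent_ok P (ex i) p cr Os Os'" "ex (Suc i) = (post (ex i) p {} cr Os')\<lparr>cli := (cli (ex i))(p := C')\<rparr>"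
    using step[of i] by (auto simp: step_def split: option.splits prod.splits)
  show thesis
    by (rule that(2)[OF inv(1) sent_ok_sends[OF inv(2)]])
      (use inv(3) in \<open>auto simp: post_def packets_def\<close>)
next
  case (Receive x eo cr Os')
  obtain k src d m where x: "x = (k, src, d, m)" by (metis prod.collapse)
  show thesis
  proof (cases "is_client d")
    case False
    then obtain j where d: "d = Srv j" by (auto simp: is_client_def split: proc.splits)
    obtain L' Os u where r: "srv_recv P j src m eo (srv (ex i) j) = (L', Os, u)"
      by (metis prod.collapse)
    have inv: "x \<in> net (ex i)" "j < pn P" "sent_ok P (ex i) (Srv j) cr Os Os'" "Srv j \<notin> crashed (ex i)"
      "ex (Suc i) = (post (ex i) (Srv j) {x} cr Os')\<lparr>srv := (srv (ex i))(j := L'),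
                                             errs := errs (ex i) + (if u then 1 else 0)\<rparr>"
      using step[of i] Receive r by (simp_all add: step_def x d pkt_dst_def pkt_src_def pkt_msg_def Let_def)
    show thesis
      by (rule that(3)[OF inv(1)[unfolded x d] inv(2) r sent_ok_sends[OF inv(3)] inv(4)])
        (use inv(5) in \<open>auto simp: post_def packets_def x d\<close>)
  next
    case True
    obtain C' Os where r: "cli_recv P d src m (cli (ex i) d) = (C', Os)"
      by (metis prod.collapse)
    have "step P (ex i) (Receive x eo cr Os') (ex (Suc i))"
      using step[of i] Receive by simp
    then have "x \<in> net (ex i) \<and> sent_ok P (ex i) d cr Os Os' \<and>
        ex (Suc i) = (post (ex i) d {x} cr Os')\<lparr>cli := (cli (ex i))(d := C')\<rparr>"
      using True r by (cases d) (simp_all add: step_def x pkt_dst_def pkt_src_def pkt_msg_def is_client_def)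
    then have inv: "x \<in> net (ex i)" "sent_ok P (ex i) d cr Os Os'"
      "ex (Suc i) = (post (ex i) d {x} cr Os')\<lparr>cli := (cli (ex i))(d := C')\<rparr>"
      by blast+
    show thesis
      by (rule that(4)[OF inv(1)[unfolded x] True r sent_ok_sends[OF inv(2)]])
        (use inv(3) in \<open>auto simp: post_def packets_def x\<close>)
  qed
qed (use step[of i] that(1) in \<open>auto simp: step_def\<close>)

lemma crashed_Suc [consumes 0, case_names same crash]:
  obtains "crashed (ex (Suc i)) = crashed (ex i)"
  | p where "can_crash P (ex i) p" "crashed (ex (Suc i)) = insert p (crashed (ex i))"
proof (cases "act i")
  case (Invoke p inp cr Os')
  then show thesis using step[of i] that(1) that(2)[of p]
    by (auto simp: step_def post_def sent_ok_def split: option.splits prod.splits if_splits)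
next
  case (Receive x eo cr Os')
  show thesis
  proof (cases cr)
    case True
    then show thesis using step[of i] Receive that(2)[of "pkt_dst x"]
      by (cases "pkt_dst x") (auto simp: step_def post_def sent_ok_def Let_def split: prod.splits)
  next
    case False
    then show thesis using step[of i] Receive that(1)
      by (cases "pkt_dst x") (auto simp: step_def post_def sent_ok_def Let_def split: prod.splits)
  qed
qed (use step[of i] that in \<open>auto simp: step_def\<close>)

section \<open>Crashes and correct servers\<close>

lemma crashed_mono: "i \<le> j \<Longrightarrow> crashed (ex i) \<subseteq> crashed (ex j)"
proof (induction rule: dec_induct)
  case (step k)
  then show ?case using crashed_Suc[of k] by blast
qed simp

lemma crashed_servers:
  "{j. Srv j \<in> crashed (ex i)} \<subseteq> {..<pn P} \<and> card {j. Srv j \<in> crashed (ex i)} \<le> pf P"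
proof (induction i)
  case 0
  then show ?case by (simp add: ex_0 init_def)
next
  case (Suc i)
  show ?case
  proof (cases rule: crashed_Suc[of i])
    case (crash p)
    show ?thesis
    proof (cases p)
      case (Srv j)
      then have "{j. Srv j \<in> crashed (ex (Suc i))} = insert j {j. Srv j \<in> crashed (ex i)}"
        using crash by auto
      then show ?thesis using crash Srv Suc card_insert_le_m1[of "pf P"]
        by (auto simp: can_crash_def finite_subset card_insert_if)
    qed (use crash Suc in auto)
  qed (use Suc in simp)
qed

definition correct :: "nat set" where
  "correct = {j. j < pn P \<and> (\<forall>i. Srv j \<notin> crashed (ex i))}"

lemma card_correct: "pn P - pf P \<le> card correct"
proof -
  define F where "F = {j. \<exists>i. Srv j \<in> crashed (ex i)}"
  have F: "F \<subseteq> {..<pn P}" using crashed_servers by (auto simp: F_def)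
  then have "finite F" by (rule finite_subset) simp
  \<comment> \<open>The bound \<open>f\<close> holds at each single time, whereas \<open>F\<close>
    collects crashes over all times. As \<open>F\<close> is finite and crashes are permanent, one
    time already shows all of them.\<close>
  moreover have "\<exists>i. G \<subseteq> {j. Srv j \<in> crashed (ex i)}" if "finite G" "G \<subseteq> F" for G
    using that
  proof (induction G rule: finite_induct)
    case (insert x G)
    then obtain i i' where "G \<subseteq> {j. Srv j \<in> crashed (ex i)}" "Srv x \<in> crashed (ex i')"
      by (auto simp: F_def)
    then have "insert x G \<subseteq> {j. Srv j \<in> crashed (ex (max i i'))}"
      using crashed_mono[of i "max i i'"] crashed_mono[of i' "max i i'"] by auto
    then show ?case by blast
  qed simp
  ultimately obtain i where i: "F \<subseteq> {j. Srv j \<in> crashed (ex i)}" by blast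
  have "card F \<le> card {j. Srv j \<in> crashed (ex i)}"
    by (rule card_mono[OF _ i]) (use crashed_servers finite_subset in blast)
  then have "card F \<le> pf P" using crashed_servers[of i] by linarith
  moreover have "correct = {..<pn P} - F" by (auto simp: correct_def F_def)
  ultimately show ?thesis using F by (simp add: card_Diff_subset \<open>finite F\<close>)
qed

lemma finite_correct: "finite correct"
  by (simp add: correct_def)

text \<open>Positivity of \<open>k\<close> rules out truncation in the subtractions of naturals, so
  the read quorum is exactly the guaranteed number of correct servers.\<close>

lemma kk_total: "kk P + 2 * pe P = pn P - pf P"
  using kk_pos by (simp add: kk_def)

text \<open>A history variable: delivery removes a packet from \<open>net\<close>, but conclusions
  drawn from its having been sent must persist. The stamp is forgotten, so resending the same
  content is nothing new.\<close>

definition sent :: "nat \<Rightarrow> proc \<Rightarrow> proc \<Rightarrow> ('v, 'c) msg \<Rightarrow> bool" where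
  "sent i p d m \<longleftrightarrow> (\<exists>j\<le>i. \<exists>k. (k, p, d, m) \<in> net (ex j))"

lemma sent_0: "\<not> sent 0 p d m"
  by (simp add: sent_def ex_0 init_def)

lemma sent_mono: "sent i p d m \<Longrightarrow> i \<le> j \<Longrightarrow> sent j p d m"
  by (auto simp: sent_def intro: order_trans)

lemma sent_Suc: "sent i p d m \<Longrightarrow> sent (Suc i) p d m"
  by (rule sent_mono) auto

lemma sent_Suc_iff: "sent (Suc i) p d m \<longleftrightarrow> sent i p d m \<or> (\<exists>k. (k, p, d, m) \<in> net (ex (Suc i)))"
  by (auto simp: sent_def le_Suc_eq)

lemma net_sent: "(k, p, d, m) \<in> net (ex i) \<Longrightarrow> sent i p d m"
  by (auto simp: sent_def)

section \<open>Steps seen from a single process\<close>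

definition srv_event where
  "srv_event i j src m Os Os' \<longleftrightarrow> (\<exists>k eo u. (k, src, Srv j, m) \<in> net (ex i) \<and> j < pn P \<and>
     Srv j \<notin> crashed (ex i) \<and> srv_recv P j src m eo (srv (ex i) j) = (srv (ex (Suc i)) j, Os, u) \<and>
     sends i (Srv j) Os Os' \<and> packets i (Srv j) Os' \<subseteq> net (ex (Suc i)))"

definition cli_event where
  "cli_event i p src m Os Os' \<longleftrightarrow> (\<exists>k. (k, src, p, m) \<in> net (ex i) \<and> is_client p \<and>
     cli_recv P p src m (cli (ex i) p) = (cli (ex (Suc i)) p, Os) \<and>
     sends i p Os Os' \<and> packets i p Os' \<subseteq> net (ex (Suc i)))"

definition inv_event where
  "inv_event i p inp Os Os' \<longleftrightarrow> cli_inv P p inp (cli (ex i) p) = Some (cli (ex (Suc i)) p, Os) \<and>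
     sends i p Os Os' \<and> packets i p Os' \<subseteq> net (ex (Suc i))"

lemma srv_change:
  assumes "srv (ex (Suc i)) j \<noteq> srv (ex i) j"
  obtains src m Os Os' where "srv_event i j src m Os Os'"
proof (cases rule: step_cases[of i])
  case (server k src j' m eo L' Os u Os')
  then have "j' = j" using assms by (auto split: if_splits)
  then have "srv_event i j src m Os Os'"
    unfolding srv_event_def using server by (intro exI[of _ k] exI[of _ eo] exI[of _ u]) simp
  then show ?thesis by (rule that)
qed (use assms in auto)

lemma cli_change:
  assumes "cli (ex (Suc i)) p \<noteq> cli (ex i) p"
  obtains (recv) src m Os Os' where "cli_event i p src m Os Os'" | (inv) inp Os Os' where "inv_event i p inp Os Os'"
proof (cases rule: step_cases[of i])
  case (client k src p' m C' Os Os')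
  then have "p' = p" using assms by (auto split: if_splits)
  then have "cli_event i p src m Os Os'"
    unfolding cli_event_def using client by (intro exI[of _ k]) simp
  then show ?thesis by (rule recv)
next
  case (invoke p' inp C' Os Os')
  then have "p' = p" using assms by (auto split: if_splits)
  then have "inv_event i p inp Os Os'"
    unfolding inv_event_def using invoke by simp
  then show ?thesis by (rule inv)
qed (use assms in auto)

text \<open>The induction step for every claim about all messages sent so far: content that is new
  must be output of the current step, by the sender named in the packet.\<close>

lemma new_sent [consumes 2, case_names server client invoke]:
  assumes "sent (Suc i) p d m" "\<not> sent i p d m"
  obtains (server) j src m' Os Os' where "p = Srv j" "srv_event i j src m' Os Os'" "(d, m) \<in> set Os'"
  | (client) src m' Os Os' where "cli_event i p src m' Os Os'" "(d, m) \<in> set Os'"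
  | (invoke) inp Os Os' where "inv_event i p inp Os Os'" "(d, m) \<in> set Os'"
proof -
  from assms obtain k where k: "(k, p, d, m) \<in> net (ex (Suc i))" "(k, p, d, m) \<notin> net (ex i)"
    using net_sent[of _ p d m i] sent_Suc_iff[of i p d m] by blast
  show thesis
  proof (cases rule: step_cases[of i])
    case (server k' src j m' eo L' Os u Os')
    then have "p = Srv j" "(d, m) \<in> set Os'" using k by (auto simp: packets_def)
    moreover have "srv_event i j src m' Os Os'" unfolding srv_event_def
      using server by (intro exI[of _ k'] exI[of _ eo] exI[of _ u]) simp
    ultimately show ?thesis using that(1) by blast
  next
    case (client k' src p' m' C' Os Os')
    then have "p' = p" "(d, m) \<in> set Os'" using k by (auto simp: packets_def)
    moreover have "cli_event i p' src m' Os Os'" unfolding cli_event_def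
      using client by (intro exI[of _ k']) simp
    ultimately show ?thesis using that(2) by blast
  next
    case (invoke p' inp C' Os Os')
    then have "p' = p" "(d, m) \<in> set Os'" using k by (auto simp: packets_def)
    moreover have "inv_event i p' inp Os Os'" unfolding inv_event_def using invoke by simp
    ultimately show ?thesis using that(3) by blast
  qed (use k in auto)
qed

lemma packets_sent: "packets i p Os \<subseteq> net (ex (Suc i)) \<Longrightarrow> (d, m) \<in> set Os \<Longrightarrow> sent (Suc i) p d m"
  by (rule net_sent[of "nid (ex i)"]) (auto simp: packets_def)

lemma srv_event_recv:
  assumes "srv_event i j src m Os Os'"
  obtains eo u k where "srv_recv P j src m eo (srv (ex i) j) = (srv (ex (Suc i)) j, Os, u)"
    "sent i src (Srv j) m" "j < pn P" "Srv j \<notin> crashed (ex i)" "Os' = take k Os"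
    "Srv j \<notin> crashed (ex (Suc i)) \<Longrightarrow> Os' = Os" "\<And>d m. (d, m) \<in> set Os' \<Longrightarrow> sent (Suc i) (Srv j) d m"
  using assms packets_sent net_sent unfolding srv_event_def sends_def by blast

lemma cli_event_recv:
  assumes "cli_event i p src m Os Os'"
  obtains k where "cli_recv P p src m (cli (ex i) p) = (cli (ex (Suc i)) p, Os)"
    "sent i src p m" "is_client p" "Os' = take k Os"
    "p \<notin> crashed (ex (Suc i)) \<Longrightarrow> Os' = Os" "\<And>d m. (d, m) \<in> set Os' \<Longrightarrow> sent (Suc i) p d m"
  using assms packets_sent net_sent unfolding cli_event_def sends_def by blast

lemma inv_event_cases:
  assumes "inv_event i p inp Os Os'"
  obtains (inv_write) w v where "p = Wr w" "ph (cli (ex i) p) = Idle"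
    "cnt (cli (ex (Suc i)) p) = Suc (cnt (cli (ex i) p))"
    "ph (cli (ex (Suc i)) p) = WQuery (Suc (cnt (cli (ex i) p))) v {} t0"
    "Os = map (\<lambda>j. (Srv j, QTag (Suc (cnt (cli (ex i) p))))) [0..<pn P]"
  | (inv_read) r where "p = Rd r" "ph (cli (ex i) p) = Idle"
    "cnt (cli (ex (Suc i)) p) = Suc (cnt (cli (ex i) p))"
    "ph (cli (ex (Suc i)) p) = RQuery (Suc (cnt (cli (ex i) p))) {} t0"
    "Os = map (\<lambda>j. (Srv j, QTag (Suc (cnt (cli (ex i) p))))) [0..<pn P]"
  using assms unfolding inv_event_def by (blast elim: cli_inv_cases)

lemma inv_event_sends:
  assumes "inv_event i p inp Os Os'" "(d, m) \<in> set Os'"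
  obtains oc where "m = QTag oc"
proof -
  have "(d, m) \<in> set Os"
    using assms by (auto simp: inv_event_def sends_def dest: in_set_takeD)
  then show thesis using that by (cases rule: inv_event_cases[OF assms(1)]) auto
qed

text \<open>\<open>value_deliver\<close> runs through \<open>sorted_list_of_set (sR L)\<close>,
  which lists all registrations only if they are finite.\<close>

lemma finite_registrations: "finite (sR (srv (ex i) j))"
proof (induction i)
  case 0
  then show ?case by (simp add: ex_0 init_def)
next
  case (Suc i)
  show ?case
  proof (cases "srv (ex (Suc i)) j = srv (ex i) j")
    case False
    then show ?thesis
      by (elim srv_change srv_event_recv) (rule srv_recv_state(2)[OF _ Suc.IH])
  qed (use Suc in simp)
qed

section \<open>Dissemination of tags\<close>

definition carried :: "nat \<Rightarrow> meta \<Rightarrow> bool" where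
  "carried i mm \<longleftrightarrow> (\<exists>p d m. sent i p d m \<and> carries_meta m mm)"

text \<open>The sender may differ from relay to relay: a writer may crash after a few sends and
  leave the rest to a relay.\<close>

definition full_sent :: "nat \<Rightarrow> tag \<Rightarrow> 'v \<Rightarrow> nat \<Rightarrow> bool" where
  "full_sent i t v oc \<longleftrightarrow> (\<forall>j\<le>pf P. \<exists>p. sent i p (Srv j) (VFull t v oc))"

text \<open>The initial tag is stored everywhere from the start and comes from no write, hence the
  exception.\<close>

definition disseminated :: "nat \<Rightarrow> tag \<Rightarrow> bool" where
  "disseminated i t \<longleftrightarrow> t = t0 \<or> (\<exists>v oc. full_sent i t v oc)"

lemma carried_mono: "carried i mm \<Longrightarrow> i \<le> j \<Longrightarrow> carried j mm"
  by (auto simp: carried_def dest: sent_mono)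

lemma full_sent_mono: "full_sent i t v oc \<Longrightarrow> i \<le> j \<Longrightarrow> full_sent j t v oc"
  by (auto simp: full_sent_def dest: sent_mono)

lemma disseminated_mono: "disseminated i t \<Longrightarrow> i \<le> j \<Longrightarrow> disseminated j t"
  by (auto simp: disseminated_def dest: full_sent_mono)

text \<open>Full values are sent in server order, so even a crashing sender leaves no gap below the servers
that it reached.\<close>

lemma sent_full_initial:
  "sent i p d (VFull t v oc) \<Longrightarrow>
    \<exists>j\<le>pf P. d = Srv j \<and> (\<forall>j'\<le>j. \<exists>p. sent i p (Srv j') (VFull t v oc))"
proof (induction i arbitrary: p d)
  case 0
  then show ?case by (simp add: sent_0)
next
  case (Suc i)
  show ?case
  proof (cases "sent i p d (VFull t v oc)")
    case True
    then obtain j where j: "j \<le> pf P" "d = Srv j" "\<And>j'. j' \<le> j \<Longrightarrow> \<exists>p. sent i p (Srv j') (VFull t v oc)"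
      using Suc.IH by blast
    have "\<exists>p. sent (Suc i) p (Srv j') (VFull t v oc)" if "j' \<le> j" for j'
      using j(3)[OF that] by (auto intro: sent_Suc)
    then show ?thesis using j(1,2) by (intro exI[of _ j]) simp
  next
    case False
    with Suc.prems show ?thesis
    proof (cases rule: new_sent)
      case (server j src m' Os Os')
      from server(2) show ?thesis
      proof (rule srv_event_recv)
        fix eo u k
        assume r: "srv_recv P j src m' eo (srv (ex i) j) = (srv (ex (Suc i)) j, Os, u)"
          "sent i src (Srv j) m'" "Os' = take k Os" "\<And>d m. (d, m) \<in> set Os' \<Longrightarrow> sent (Suc i) (Srv j) d m"
        from server(3)[unfolded r(3)] show ?thesis
        proof (rule srv_recv_sends_full[OF r(1) finite_registrations], fold r(3))
          fix l
          assume l: "m' = VFull t v oc" "d = Srv l" "j < l" "l \<le> pf P"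
            "\<And>j'. j < j' \<Longrightarrow> j' \<le> l \<Longrightarrow> (Srv j', VFull t v oc) \<in> set Os'"
          \<comment> \<open>Relays above \<open>j\<close> are served by this step; those up to
            \<open>j\<close> were served before, by the induction hypothesis for the message that
            \<open>j\<close> itself received.\<close>
          have "\<exists>p. sent (Suc i) p (Srv j') (VFull t v oc)" if "j' \<le> l" for j'
          proof (cases "j < j'")
            case True
            then show ?thesis using l(5) r(4) that by blast
          next
            case False
            then obtain q where "sent i q (Srv j') (VFull t v oc)" using Suc.IH[OF r(2)[unfolded l(1)]] leI[OF False] by auto
            then show ?thesis by (auto intro: sent_Suc)
          qed
          then show ?thesis using l(2,4) by (intro exI[of _ l]) simp
        qed
      qed
    next
      case (client src m' Os Os')
      from client(1) show ?thesis
      proof (rule cli_event_recv)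
        fix k
        assume r: "cli_recv P p src m' (cli (ex i) p) = (cli (ex (Suc i)) p, Os)"
          "Os' = take k Os" "\<And>d m. (d, m) \<in> set Os' \<Longrightarrow> sent (Suc i) p d m"
        have mem: "(d, VFull t v oc) \<in> set Os" using client(2) r(2) by (auto dest: in_set_takeD)
        from r(1) show ?thesis
        proof (cases rule: cli_recv_cases)
          case (wsend oc' v' S tm j t' w tw)
          define g where "g = (\<lambda>j. (Srv j :: proc, VFull t v oc :: ('v, 'c) msg))"
          from mem wsend(7) obtain l where l: "d = Srv l" "l \<le> pf P" "tw = t" "v' = v" "oc' = oc" by auto
          have Os: "Os = map g [0..<pf P + 1] @ []" using wsend(7) l by (simp add: g_def)
          have "g j' \<in> set Os'" if "j' \<le> l" for j'
            unfolding r(2) Os by (rule take_map_upt_initial[where j = l])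
              (use that client(2) l in \<open>auto simp: g_def Os r(2) inj_def\<close>)
          then have "\<exists>p. sent (Suc i) p (Srv j') (VFull t v oc)" if "j' \<le> l" for j'
            using r(3) that unfolding g_def by blast
          then show ?thesis using l(1,2) by (intro exI[of _ l]) simp
        qed (use mem in \<open>auto simp: set_md_meta\<close>)
      qed
    next
      case (invoke inp Os Os')
      then show ?thesis by (auto elim: inv_event_sends)
    qed
  qed
qed

text \<open>No survival assumption is made on the sender: a coded element leaves only after all
  forwards to higher relays, and \<open>sent_full_initial\<close> covers the lower ones.\<close>

lemma sent_coded_full: "sent i p d (VCoded t c oc) \<Longrightarrow> \<exists>v. full_sent i t v oc"
proof (induction i)
  case 0
  then show ?case by (simp add: sent_0)
next
  case (Suc i)
  show ?case
  proof (cases "sent i p d (VCoded t c oc)")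
    case True
    then show ?thesis using Suc.IH full_sent_mono[of i t _ oc "Suc i"] by auto
  next
    case False
    with Suc.prems show ?thesis
    proof (cases rule: new_sent)
      case (server j src m' Os Os')
      from server(2) show ?thesis
      proof (rule srv_event_recv)
        fix eo u k
        assume r: "srv_recv P j src m' eo (srv (ex i) j) = (srv (ex (Suc i)) j, Os, u)"
          "sent i src (Srv j) m'" "Os' = take k Os" "\<And>d m. (d, m) \<in> set Os' \<Longrightarrow> sent (Suc i) (Srv j) d m"
        from server(3)[unfolded r(3)] show ?thesis
        proof (rule srv_recv_sends_coded[OF r(1) finite_registrations], fold r(3))
          fix v
          assume l: "m' = VFull t v oc"
            "\<And>j'. j < j' \<Longrightarrow> j' \<le> pf P \<Longrightarrow> (Srv j', VFull t v oc) \<in> set Os'"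
          have "\<exists>p. sent (Suc i) p (Srv j') (VFull t v oc)" if "j' \<le> pf P" for j'
          proof (cases "j < j'")
            case True
            then show ?thesis using l r(4) that by blast
          next
            case False
            then obtain q where "sent i q (Srv j') (VFull t v oc)"
              using sent_full_initial[OF r(2)[unfolded l(1)]] leI[OF False] by auto
            then show ?thesis by (auto intro: sent_Suc)
          qed
          then show ?thesis by (auto simp: full_sent_def)
        qed
      qed
    next
      case (client src m' Os Os')
      from client(1) show ?thesis
      proof (rule cli_event_recv)
        fix k
        assume r: "cli_recv P p src m' (cli (ex i) p) = (cli (ex (Suc i)) p, Os)" "Os' = take k Os"
        have mem: "(d, VCoded t c oc) \<in> set Os" using client(2) r(2) by (auto dest: in_set_takeD)
        from r(1) show ?thesis
          by (cases rule: cli_recv_cases) (use mem in \<open>auto simp: set_md_meta\<close>)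
      qed
    next
      case (invoke inp Os Os')
      then show ?thesis by (auto elim: inv_event_sends)
    qed
  qed
qed

text \<open>Survival matters here: a server that crashes in the step recording the tag may have
  forwarded nothing. A server that got a coded element instead relies on
  \<open>sent_coded_full\<close>.\<close>

lemma seen_full_sent:
  "(t, oc) \<in> vseen (srv (ex i) j) \<Longrightarrow> Srv j \<notin> crashed (ex i) \<Longrightarrow> \<exists>v. full_sent i t v oc"
proof (induction i)
  case 0
  then show ?case by (simp add: ex_0 init_def)
next
  case (Suc i)
  show ?case
  proof (cases "(t, oc) \<in> vseen (srv (ex i) j)")
    case True
    moreover have "Srv j \<notin> crashed (ex i)" using Suc.prems crashed_mono[of i "Suc i"] by auto
    ultimately show ?thesis using Suc.IH full_sent_mono[of i t _ oc "Suc i"] by auto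
  next
    case False
    then have "srv (ex (Suc i)) j \<noteq> srv (ex i) j" using Suc.prems by auto
    then obtain src m Os Os' where "srv_event i j src m Os Os'" by (rule srv_change)
    then show ?thesis
    proof (rule srv_event_recv)
      fix eo u
      assume r: "srv_recv P j src m eo (srv (ex i) j) = (srv (ex (Suc i)) j, Os, u)"
        "sent i src (Srv j) m" "Srv j \<notin> crashed (ex (Suc i)) \<Longrightarrow> Os' = Os"
        "\<And>d m. (d, m) \<in> set Os' \<Longrightarrow> sent (Suc i) (Srv j) d m"
      from r(1) finite_registrations Suc.prems(1) False show ?thesis
      proof (cases rule: srv_recv_full_forward)
        case (1 v)
        have "\<exists>p. sent (Suc i) p (Srv j') (VFull t v oc)" if "j' \<le> pf P" for j'
        proof (cases "j < j'")
          case True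
          then show ?thesis using 1(2) r(3,4) Suc.prems(2) that by blast
        next
          case False
          then obtain q where "sent i q (Srv j') (VFull t v oc)"
            using sent_full_initial[OF r(2)[unfolded 1(1)]] leI[OF False] by auto
          then show ?thesis by (auto intro: sent_Suc)
        qed
        then show ?thesis by (auto simp: full_sent_def)
      next
        case (2 c)
        then show ?thesis
          using sent_coded_full[OF r(2)[unfolded 2(1)]] full_sent_mono[of i t _ oc "Suc i"] by auto
      qed
    qed
  qed
qed

text \<open>The first half traces a stored tag back to a delivery. The second shows that a tag above
  the stored one has not been delivered yet.\<close>

lemma server_tag:
  "(stag (srv (ex i) j) = t0 \<or> (\<exists>oc. (stag (srv (ex i) j), oc) \<in> vseen (srv (ex i) j))) \<and>
   (\<forall>(t, oc) \<in> vseen (srv (ex i) j). t \<le> stag (srv (ex i) j))"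
proof (induction i)
  case 0
  then show ?case by (simp add: ex_0 init_def)
next
  case (Suc i)
  show ?case
  proof (cases "srv (ex (Suc i)) j = srv (ex i) j")
    case False
    then obtain src m Os Os' where "srv_event i j src m Os Os'" by (rule srv_change)
    then show ?thesis
    proof (rule srv_event_recv)
      fix eo u
      assume r: "srv_recv P j src m eo (srv (ex i) j) = (srv (ex (Suc i)) j, Os, u)"
      note st = srv_recv_state[OF r finite_registrations]
      have "t \<le> stag (srv (ex (Suc i)) j)" if "(t, oc) \<in> vseen (srv (ex (Suc i)) j)" for t oc
        using st(1) st(8)[OF that] Suc.IH order_trans by blast
      moreover have "stag (srv (ex (Suc i)) j) = t0 \<or>
          (\<exists>oc. (stag (srv (ex (Suc i)) j), oc) \<in> vseen (srv (ex (Suc i)) j))"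
        using st(3,7) Suc.IH by (cases "stag (srv (ex (Suc i)) j) = stag (srv (ex i) j)") auto
      ultimately show ?thesis by blast
    qed
  qed (use Suc in simp)
qed

lemma server_tag_disseminated:
  "Srv j \<notin> crashed (ex i) \<Longrightarrow> disseminated i (stag (srv (ex i) j))"
  using server_tag[of i j] seen_full_sent[of _ _ i j] unfolding disseminated_def by blast

text \<open>The answering server is alive when its step begins and reports the tag stored at that
  moment, so a crash during the reply does no harm.\<close>

lemma sent_tag_disseminated: "sent i p d (RTag oc t) \<Longrightarrow> disseminated i t"
proof (induction i)
  case 0
  then show ?case by (simp add: sent_0)
next
  case (Suc i)
  have "disseminated i t"
  proof (cases "sent i p d (RTag oc t)")
    case False
    with Suc.prems show ?thesis
    proof (cases rule: new_sent)
      case (server j src m' Os Os')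
      from server(2) show ?thesis
      proof (rule srv_event_recv)
        fix eo u k
        assume r: "srv_recv P j src m' eo (srv (ex i) j) = (srv (ex (Suc i)) j, Os, u)"
          "Os' = take k Os" "Srv j \<notin> crashed (ex i)"
        have "(d, RTag oc t) \<in> set Os" using server(3) r(2) by (auto dest: in_set_takeD)
        then show ?thesis
          using srv_recv_sends_tag[OF r(1) finite_registrations, of d oc t] server_tag_disseminated[OF r(3)] by simp
      qed
    next
      case (client src m' Os Os')
      from client(1) show ?thesis
      proof (rule cli_event_recv)
        fix k
        assume r: "cli_recv P p src m' (cli (ex i) p) = (cli (ex (Suc i)) p, Os)" "Os' = take k Os"
        have mem: "(d, RTag oc t) \<in> set Os" using client(2) r(2) by (auto dest: in_set_takeD)
        from r(1) show ?thesis
          by (cases rule: cli_recv_cases) (use mem in \<open>auto simp: set_md_meta\<close>)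
      qed
    next
      case (invoke inp Os Os')
      then show ?thesis by (auto elim: inv_event_sends)
    qed
  qed (rule Suc.IH)
  then show ?case by (rule disseminated_mono) simp
qed

subsection \<open>Fairness\<close>

text \<open>Fairness only promises a later time without the packet; a packet that no step removes
  would stay forever, so some step takes it out.\<close>

lemma packet_removed:
  assumes "x \<in> net (ex i)" "\<forall>j. pkt_dst x \<notin> crashed (ex j)"
  obtains l where "i \<le> l" "x \<in> net (ex l)" "x \<notin> net (ex (Suc l))"
proof (rule ccontr)
  assume "\<not> thesis"
  then have *: "x \<in> net (ex (Suc l))" if "x \<in> net (ex l)" "i \<le> l" for l
    using that(1,2) \<open>\<And>l. i \<le> l \<Longrightarrow> x \<in> net (ex l) \<Longrightarrow> x \<notin> net (ex (Suc l)) \<Longrightarrow> thesis\<close> by blast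
  have "x \<in> net (ex l)" if "i \<le> l" for l
    using that by (induction rule: dec_induct) (use assms(1) * in auto)
  then show False using fair_delivery[OF assms] by blast
qed

text \<open>Only receipt by the destination removes a packet. A correct recipient sends its full
  output, hence the same \<open>Os\<close> in both places.\<close>

lemma server_delivery:
  assumes "(k, src, Srv j, m) \<in> net (ex i)" "j \<in> correct"
  obtains l Os where "i \<le> l" "srv_event l j src m Os Os"
proof -
  have alive: "\<forall>i. Srv j \<notin> crashed (ex i)" using assms(2) by (simp add: correct_def)
  obtain l where l: "i \<le> l" "(k, src, Srv j, m) \<in> net (ex l)" "(k, src, Srv j, m) \<notin> net (ex (Suc l))"
    by (rule packet_removed[OF assms(1)]) (use alive in \<open>auto simp: pkt_dst_def\<close>)
  show thesis
  proof (cases rule: step_cases[of l])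
    case (server k' src' j' m' eo L' Os u Os')
    then have eq: "k' = k" "src' = src" "j' = j" "m' = m" using l by auto
    have "Os' = Os" using server(4) alive eq by (simp add: sends_def)
    then have "srv_event l j src m Os Os"
      unfolding srv_event_def using server eq by (intro exI[of _ k] exI[of _ eo] exI[of _ u]) simp
    then show thesis using that l(1) by blast
  next
    case (client k' src' p m' C' Os Os')
    then have "p = Srv j" using l by auto
    then show thesis using client(2) by (simp add: is_client_def)
  qed (use l in auto)
qed

lemma server_delivery_sent:
  assumes "sent i src (Srv j) m" "j \<in> correct"
  obtains l Os where "srv_event l j src m Os Os"
proof -
  obtain k i' where "(k, src, Srv j, m) \<in> net (ex i')" using assms(1) by (auto simp: sent_def)
  then obtain l Os where "srv_event l j src m Os Os" using assms(2) by (rule server_delivery)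
  then show thesis by (rule that)
qed

lemma client_delivery:
  assumes "(k, src, p, m) \<in> net (ex i)" "\<forall>i. p \<notin> crashed (ex i)" "is_client p"
  obtains l Os where "i \<le> l" "cli_event l p src m Os Os"
proof -
  obtain l where l: "i \<le> l" "(k, src, p, m) \<in> net (ex l)" "(k, src, p, m) \<notin> net (ex (Suc l))"
    by (rule packet_removed[OF assms(1)]) (use assms(2) in \<open>auto simp: pkt_dst_def\<close>)
  show thesis
  proof (cases rule: step_cases[of l])
    case (server k' src' j' m' eo L' Os u Os')
    then have "p = Srv j'" using l by auto
    then show thesis using assms(3) by (simp add: is_client_def)
  next
    case (client k' src' p' m' C' Os Os')
    then have eq: "k' = k" "src' = src" "p' = p" "m' = m" using l by auto
    have "Os' = Os" using client(4) assms(2) eq by (simp add: sends_def)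
    then have "cli_event l p src m Os Os"
      unfolding cli_event_def using client eq by (intro exI[of _ k]) simp
    then show thesis using that l(1) by blast
  qed (use l in auto)
qed

lemma srv_event_correct: "srv_event i j src m Os Os' \<Longrightarrow> j \<in> correct \<Longrightarrow> Os' = Os"
  by (auto simp: srv_event_def sends_def correct_def)

lemma srv_event_packet:
  assumes "srv_event i j src m Os Os" "(d, m') \<in> set Os"
  shows "(nid (ex i), Srv j, d, m') \<in> net (ex (Suc i))"
  using assms by (auto simp: srv_event_def packets_def)

lemma server_mono:
  assumes "i \<le> k"
  shows "vseen (srv (ex i) j) \<subseteq> vseen (srv (ex k) j) \<and> mseen (srv (ex i) j) \<subseteq> mseen (srv (ex k) j)"
  using assms
proof (induction rule: dec_induct)
  case (step l)
  have "vseen (srv (ex l) j) \<subseteq> vseen (srv (ex (Suc l)) j) \<and> mseen (srv (ex l) j) \<subseteq> mseen (srv (ex (Suc l)) j)"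
  proof (cases "srv (ex (Suc l)) j = srv (ex l) j")
    case False
    then obtain src m Os Os' where "srv_event l j src m Os Os'" by (rule srv_change)
    then obtain eo u where "srv_recv P j src m eo (srv (ex l) j) = (srv (ex (Suc l)) j, Os, u)"
      by (auto simp: srv_event_def)
    from srv_recv_state(3,4)[OF this finite_registrations] show ?thesis by simp
  qed simp
  then show ?case using step by blast
qed simp

section \<open>First receipts and relaying to all correct servers\<close>

lemma first_seen:
  assumes "(t, oc) \<in> vseen (srv (ex k) j)" "j \<in> correct"
  obtains l src m Os where "l < k" "(t, oc) \<notin> vseen (srv (ex l) j)" "(t, oc) \<in> vseen (srv (ex (Suc l)) j)"
    "srv_event l j src m Os Os"
proof -
  have "(t, oc) \<notin> vseen (srv (ex 0) j)" by (simp add: ex_0 init_def)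
  with ex_least_nat_less[of "\<lambda>k. (t, oc) \<in> vseen (srv (ex k) j)"] assms(1)
  obtain l where l: "l < k" "(t, oc) \<notin> vseen (srv (ex l) j)" "(t, oc) \<in> vseen (srv (ex (Suc l)) j)"
    by auto
  then have "srv (ex (Suc l)) j \<noteq> srv (ex l) j" by auto
  then obtain src m Os Os' where "srv_event l j src m Os Os'" by (rule srv_change)
  moreover from this have "Os' = Os" using assms(2) by (rule srv_event_correct)
  ultimately show thesis using that[OF l] by simp
qed

lemma first_meta_seen:
  assumes "mm \<in> mseen (srv (ex k) j)" "j \<in> correct"
  obtains l src m Os where "l < k" "mm \<notin> mseen (srv (ex l) j)" "mm \<in> mseen (srv (ex (Suc l)) j)"
    "srv_event l j src m Os Os"
proof -
  have "mm \<notin> mseen (srv (ex 0) j)" by (simp add: ex_0 init_def)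
  with ex_least_nat_less[of "\<lambda>k. mm \<in> mseen (srv (ex k) j)"] assms(1)
  obtain l where l: "l < k" "mm \<notin> mseen (srv (ex l) j)" "mm \<in> mseen (srv (ex (Suc l)) j)"
    by auto
  then have "srv (ex (Suc l)) j \<noteq> srv (ex l) j" by auto
  then obtain src m Os Os' where "srv_event l j src m Os Os'" by (rule srv_change)
  moreover from this have "Os' = Os" using assms(2) by (rule srv_event_correct)
  ultimately show thesis using that[OF l] by simp
qed

text \<open>At most \<open>f\<close> of the \<open>f + 1\<close> relays crash: otherwise the correct
  servers would all lie among the remaining \<open>n - f - 1\<close>, fewer than
  \<open>n - f\<close>.\<close>

lemma correct_relay: "\<exists>a\<in>correct. a \<le> pf P"
proof (rule ccontr)
  assume "\<not> ?thesis"
  then have "correct \<subseteq> {Suc (pf P)..<pn P}" by (auto simp: correct_def not_le)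
  then have "card correct \<le> pn P - Suc (pf P)" using card_mono[of "{Suc (pf P)..<pn P}" correct] by simp
  then show False using card_correct majority by linarith
qed

lemma srv_event_run:
  assumes "srv_event i j src m Os Os'"
  obtains eo u where "srv_recv P j src m eo (srv (ex i) j) = (srv (ex (Suc i)) j, Os, u)"
  using assms by (auto simp: srv_event_def)

lemma srv_event_seen:
  assumes "srv_event i j src m Os Os'"
  shows "m = VFull t v oc \<Longrightarrow> (t, oc) \<in> vseen (srv (ex (Suc i)) j)"
    "m = VCoded t c oc \<Longrightarrow> pf P < j \<Longrightarrow> (t, oc) \<in> vseen (srv (ex (Suc i)) j)"
    "m = MMeta mm \<Longrightarrow> mm \<in> mseen (srv (ex (Suc i)) j)"
    "m = MMetaD mm \<Longrightarrow> pf P < j \<Longrightarrow> mm \<in> mseen (srv (ex (Suc i)) j)"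
  by (rule srv_event_run[OF assms], drule srv_recv_seen[OF _ finite_registrations]; simp)+

text \<open>Two hops: a correct relay receives the full value directly, and at its first receipt it
  sends coded elements to everybody. That receipt may concern a value other than \<open>v\<close>;
  only the identifier \<open>(t, oc)\<close> is followed.\<close>

lemma full_sent_seen:
  assumes "full_sent i t v oc" "s \<in> correct"
  shows "\<exists>k. (t, oc) \<in> vseen (srv (ex k) s)"
proof -
  have low: "\<exists>k. (t, oc) \<in> vseen (srv (ex k) a)" if a: "a \<in> correct" "a \<le> pf P" for a
  proof -
    obtain q where "sent i q (Srv a) (VFull t v oc)"
      using assms(1) a(2) by (auto simp: full_sent_def)
    then obtain l Os where "srv_event l a q (VFull t v oc) Os Os"
      using a(1) by (rule server_delivery_sent)
    then show ?thesis
      using srv_event_seen(1)[OF _ refl] by blast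
  qed
  show ?thesis
  proof (cases "s \<le> pf P")
    case False
    obtain a k where a: "a \<in> correct" "a \<le> pf P" "(t, oc) \<in> vseen (srv (ex k) a)"
      using correct_relay low by blast
    obtain l src m Os where l: "(t, oc) \<notin> vseen (srv (ex l) a)" "(t, oc) \<in> vseen (srv (ex (Suc l)) a)"
      "srv_event l a src m Os Os" by (rule first_seen[OF a(3,1)])
    from l(3) obtain eo u where r: "srv_recv P a src m eo (srv (ex l) a) = (srv (ex (Suc l)) a, Os, u)"
      by (auto simp: srv_event_def)
    from r finite_registrations l(2,1) show ?thesis
    proof (cases rule: srv_recv_full_forward)
      case (1 v')
      have "s < pn P" "s \<noteq> a" using assms(2) a(2) False by (auto simp: correct_def)
      then have "(nid (ex l), Srv a, Srv s, VCoded t (pPhi P s v') oc) \<in> net (ex (Suc l))"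
        using 1(3) srv_event_packet[OF l(3)] by blast
      then obtain l' Os' where "srv_event l' s (Srv a) (VCoded t (pPhi P s v') oc) Os' Os'"
        using assms(2) by (rule server_delivery)
      then have "(t, oc) \<in> vseen (srv (ex (Suc l')) s)"
        by (rule srv_event_seen(2)[OF _ refl]) (use False in simp)
      then show ?thesis by blast
    next
      \<comment> \<open>A relay ignores coded elements, so its first receipt cannot be one.\<close>
      case (2 c)
      then show ?thesis using a(2) by simp
    qed
  qed (use low assms(2) in blast)
qed

definition relayed :: "nat \<Rightarrow> meta \<Rightarrow> bool" where
  "relayed i mm \<longleftrightarrow> (\<forall>j\<le>pf P. \<exists>q. sent i q (Srv j) (MMeta mm))"

lemma relayed_mono: "relayed i mm \<Longrightarrow> i \<le> j \<Longrightarrow> relayed j mm"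
  by (auto simp: relayed_def dest: sent_mono)

lemma relayed_seen:
  assumes "relayed i mm" "s \<in> correct"
  shows "\<exists>k. mm \<in> mseen (srv (ex k) s)"
proof -
  have low: "\<exists>k. mm \<in> mseen (srv (ex k) a)" if a: "a \<in> correct" "a \<le> pf P" for a
  proof -
    obtain q where "sent i q (Srv a) (MMeta mm)" using assms(1) a(2) by (auto simp: relayed_def)
    then obtain l Os where "srv_event l a q (MMeta mm) Os Os"
      using a(1) by (rule server_delivery_sent)
    then show ?thesis
      using srv_event_seen(3)[OF _ refl] by blast
  qed
  show ?thesis
  proof (cases "s \<le> pf P")
    case False
    obtain a k where a: "a \<in> correct" "a \<le> pf P" "mm \<in> mseen (srv (ex k) a)"
      using correct_relay low by blast
    obtain l src m Os where l: "mm \<notin> mseen (srv (ex l) a)" "mm \<in> mseen (srv (ex (Suc l)) a)"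
      "srv_event l a src m Os Os" by (rule first_meta_seen[OF a(3,1)])
    from l(3) obtain eo u where r: "srv_recv P a src m eo (srv (ex l) a) = (srv (ex (Suc l)) a, Os, u)"
      by (auto simp: srv_event_def)
    have "s < pn P" "s \<noteq> a" using assms(2) a(2) False by (auto simp: correct_def)
    then have "(Srv s, MMetaD mm) \<in> set Os"
      by (rule srv_recv_meta_forward[OF r finite_registrations l(2,1) a(2)])
    then have "(nid (ex l), Srv a, Srv s, MMetaD mm) \<in> net (ex (Suc l))"
      using srv_event_packet[OF l(3)] by blast
    then obtain l' Os' where "srv_event l' s (Srv a) (MMetaD mm) Os' Os'"
      using assms(2) by (rule server_delivery)
    then have "mm \<in> mseen (srv (ex (Suc l')) s)"
        by (rule srv_event_seen(4)[OF _ refl]) (use False in simp)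
      then show ?thesis by blast
  qed (use low assms(2) in blast)
qed

subsection \<open>Client invariants\<close>

lemma cli_event_facts:
  assumes "cli_event i p src m Os Os'"
  shows "cli_recv P p src m (cli (ex i) p) = (cli (ex (Suc i)) p, Os)" "sent i src p m"
    "p \<notin> crashed (ex (Suc i)) \<Longrightarrow> Os' = Os" "(d, m') \<in> set Os' \<Longrightarrow> (d, m') \<in> set Os"
    "(d, m') \<in> set Os' \<Longrightarrow> sent (Suc i) p d m'" "is_client p"
  using assms packets_sent net_sent by (auto simp: cli_event_def sends_def dest: in_set_takeD)

text \<open>Each phase records that its quorum is still missed, which later contradicts replies from
  all correct servers. What the client broadcast is asserted only while it is alive, since a crash
  may cut the broadcast short.\<close>

definition client_inv :: "nat \<Rightarrow> proc \<Rightarrow> bool" where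
  "client_inv i p \<longleftrightarrow> (case ph (cli (ex i) p) of
     Idle \<Rightarrow> True
   | WQuery oc v S tm \<Rightarrow> (\<exists>w. p = Wr w) \<and> oc = cnt (cli (ex i) p) \<and> finite S \<and> 2 * card S \<le> pn P
   | WWait oc tw A \<Rightarrow> p = Wr (snd tw) \<and> oc = cnt (cli (ex i) p) \<and> finite A \<and> card A < kk P \<and>
       (p \<notin> crashed (ex i) \<longrightarrow> (\<exists>v. full_sent i tw v oc))
   | RQuery oc S tm \<Rightarrow> (\<exists>r. p = Rd r) \<and> oc = cnt (cli (ex i) p) \<and> finite S \<and> 2 * card S \<le> pn P \<and>
       disseminated i tm
   | RWait oc tr M \<Rightarrow> (\<exists>r. p = Rd r \<and> (p \<notin> crashed (ex i) \<longrightarrow> relayed i (ReadValue (r, oc) tr))) \<and>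
       oc = cnt (cli (ex i) p) \<and> disseminated i tr \<and>
       (\<forall>t. finite {x. M x t \<noteq> None} \<and> card {x. M x t \<noteq> None} < kk P + 2 * pe P))"

lemma client_inv_mono:
  assumes "client_inv i p" "cli (ex (Suc i)) p = cli (ex i) p"
  shows "client_inv (Suc i) p"
proof -
  have c: "p \<notin> crashed (ex i)" if "p \<notin> crashed (ex (Suc i))"
    using that crashed_mono[of i "Suc i"] by auto
  have f: "\<exists>v. full_sent (Suc i) t v oc" if "\<exists>v. full_sent i t v oc" for t oc
    using that full_sent_mono[of i t _ oc "Suc i"] by auto
  have d: "disseminated (Suc i) t" if "disseminated i t" for t
    using that by (rule disseminated_mono) simp
  have s: "relayed (Suc i) mm" if "relayed i mm" for mm
    using that by (rule relayed_mono) simp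
  show ?thesis
    using assms c f d s unfolding client_inv_def assms(2)
    by (cases "ph (cli (ex i) p)") (simp_all, blast)
qed

lemma disseminated_max: "disseminated i a \<Longrightarrow> disseminated i b \<Longrightarrow> disseminated i (max a b)"
  by (simp add: max_def)

lemma client_invariant: "client_inv i p"
proof (induction i)
  case 0
  then show ?case by (simp add: client_inv_def ex_0 init_def)
next
  case (Suc i)
  show ?case
  proof (cases "cli (ex (Suc i)) p = cli (ex i) p")
    case True
    with Suc show ?thesis by (rule client_inv_mono)
  next
    case False
    then show ?thesis
    proof (cases rule: cli_change)
      case (inv inp Os Os')
      then show ?thesis
        by (cases rule: inv_event_cases) (simp_all add: client_inv_def disseminated_def)
    next
      case (recv src m Os Os')
      note r = cli_event_facts(1-3)[OF recv] cli_event_facts(5)[OF recv]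
      have c: "p \<notin> crashed (ex i)" if "p \<notin> crashed (ex (Suc i))"
        using that crashed_mono[of i "Suc i"] by auto
      have d: "disseminated (Suc i) t" if "disseminated i t" for t
        using that by (rule disseminated_mono) simp
      from r(1) show ?thesis
      proof (cases rule: cli_recv_cases)
        case same
        with Suc show ?thesis by (intro client_inv_mono) simp_all
      next
        case (wquery oc v S tm j t)
        then show ?thesis using Suc by (simp add: client_inv_def)
      next
        case (wsend oc v S tm j t w tw)
        have "full_sent (Suc i) tw v oc" if "p \<notin> crashed (ex (Suc i))"
          unfolding full_sent_def
        proof (intro allI impI)
          fix j' assume "j' \<le> pf P"
          then have "(Srv j', VFull tw v oc) \<in> set Os'" using r(3)[OF that] wsend(7) by auto
          then show "\<exists>q. sent (Suc i) q (Srv j') (VFull tw v oc)" using r(4) by blast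
        qed
        then show ?thesis using wsend Suc kk_pos by (auto simp: client_inv_def)
      next
        case (rquery oc S tm j t)
        then have "disseminated i t" using r(2) sent_tag_disseminated by simp
        then show ?thesis using rquery Suc by (simp add: client_inv_def d disseminated_max)
      next
        case (rsend oc S tm j t x)
        then have "disseminated i t" using r(2) sent_tag_disseminated by simp
        moreover have "relayed (Suc i) (ReadValue (x, oc) (max tm t))" if "p \<notin> crashed (ex (Suc i))"
          unfolding relayed_def
        proof (intro allI impI)
          fix j' assume "j' \<le> pf P"
          then have "(Srv j', MMeta (ReadValue (x, oc) (max tm t))) \<in> set Os'"
            using r(3)[OF that] rsend(6) by (auto simp: set_md_meta)
          then show "\<exists>q. sent (Suc i) q (Srv j') (MMeta (ReadValue (x, oc) (max tm t)))" using r(4) by blast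
        qed
        ultimately show ?thesis using rsend Suc kk_pos by (simp add: client_inv_def d disseminated_max)
      next
        case (ack oc tw A j)
        then show ?thesis using Suc c full_sent_mono[of i tw _ oc "Suc i"]
          by (auto simp: client_inv_def)
      next
        case (wdone oc tw A)
        then show ?thesis by (simp add: client_inv_def)
      next
        case (resp oc tr M M' j t c')
        have fin: "finite {x. M x t' \<noteq> None}" "card {x. M x t' \<noteq> None} < kk P + 2 * pe P" for t'
          using Suc resp(1) by (simp_all add: client_inv_def)
        have "finite {x. M' x t' \<noteq> None} \<and> card {x. M' x t' \<noteq> None} < kk P + 2 * pe P" for t'
        proof (cases "t' = t")
          case True
          have "{x. M' x t \<noteq> None} \<subseteq> insert j {x. M x t \<noteq> None}" by (auto simp: resp(2))
          then show ?thesis using True resp(3) fin(1)[of t] finite_subset by blast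
        next
          case False
          then have "{x. M' x t' \<noteq> None} = {x. M x t' \<noteq> None}" by (auto simp: resp(2))
          then show ?thesis using fin[of t'] by simp
        qed
        moreover have "relayed (Suc i) mm" if "relayed i mm" for mm
          using that by (rule relayed_mono) simp
        ultimately show ?thesis using Suc resp(1,4) c d
          by (auto simp: client_inv_def)
      next
        case (rdone oc tr M x v)
        then show ?thesis by (simp add: client_inv_def)
      qed
    qed
  qed
qed

section \<open>Client phases without the collected replies\<close>

definition query_op :: "('v, 'c) cloc \<Rightarrow> nat option" where
  "query_op C = (case ph C of WQuery oc v S tm \<Rightarrow> Some oc | RQuery oc S tm \<Rightarrow> Some oc | _ \<Rightarrow> None)"

text \<open>As replies are left out, the value is constant throughout one waiting phase; the replies
  are tracked separately by \<open>responders\<close>, which grows while both abstractions stay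
  fixed.\<close>

definition wait_op :: "('v, 'c) cloc \<Rightarrow> (nat \<times> tag) option" where
  "wait_op C = (case ph C of WWait oc tw A \<Rightarrow> Some (oc, tw) | RWait oc tr M \<Rightarrow> Some (oc, tr) | _ \<Rightarrow> None)"

text \<open>The tag argument matters only while a read collects coded elements; otherwise \<open>t0\<close> is passed.\<close>

definition responders :: "('v, 'c) cloc \<Rightarrow> tag \<Rightarrow> nat set" where
  "responders C t = (case ph C of WQuery oc v S tm \<Rightarrow> S | RQuery oc S tm \<Rightarrow> S | WWait oc tw A \<Rightarrow> A
     | RWait oc tr M \<Rightarrow> {x. M x t \<noteq> None} | Idle \<Rightarrow> {})"

lemma cli_event_trans:
  assumes "cli_event i p src m Os Os'"
  shows "cnt (cli (ex (Suc i)) p) = cnt (cli (ex i) p)"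
    "query_op (cli (ex (Suc i)) p) = Some oc \<Longrightarrow> query_op (cli (ex i) p) = Some oc"
    "query_op (cli (ex i) p) = Some oc \<Longrightarrow> ph (cli (ex (Suc i)) p) \<noteq> Idle \<Longrightarrow>
       query_op (cli (ex (Suc i)) p) = Some oc \<or> (\<exists>t. wait_op (cli (ex (Suc i)) p) = Some (oc, t))"
    "wait_op (cli (ex i) p) = Some x \<Longrightarrow> ph (cli (ex (Suc i)) p) \<noteq> Idle \<Longrightarrow>
       wait_op (cli (ex (Suc i)) p) = Some x"
    "wait_op (cli (ex (Suc i)) p) = Some (oc, t) \<Longrightarrow>
       wait_op (cli (ex i) p) = Some (oc, t) \<or> query_op (cli (ex i) p) = Some oc"
    "query_op (cli (ex (Suc i)) p) = query_op (cli (ex i) p) \<Longrightarrow>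
       wait_op (cli (ex (Suc i)) p) = wait_op (cli (ex i) p) \<Longrightarrow>
       responders (cli (ex i) p) t \<subseteq> responders (cli (ex (Suc i)) p) t"
  using cli_event_facts(1)[OF assms]
  by (cases rule: cli_recv_cases; force simp: query_op_def wait_op_def responders_def)+

lemma cli_step:
  shows "query_op (cli (ex (Suc i)) p) = Some oc \<Longrightarrow>
      query_op (cli (ex i) p) = Some oc \<or> oc = Suc (cnt (cli (ex i) p))"
    "cnt (cli (ex i) p) \<le> cnt (cli (ex (Suc i)) p)"
    "query_op (cli (ex i) p) = Some oc \<Longrightarrow> ph (cli (ex (Suc i)) p) \<noteq> Idle \<Longrightarrow>
       query_op (cli (ex (Suc i)) p) = Some oc \<or> (\<exists>t. wait_op (cli (ex (Suc i)) p) = Some (oc, t))"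
    "wait_op (cli (ex i) p) = Some x \<Longrightarrow> ph (cli (ex (Suc i)) p) \<noteq> Idle \<Longrightarrow>
       wait_op (cli (ex (Suc i)) p) = Some x"
    "wait_op (cli (ex (Suc i)) p) = Some (oc, t) \<Longrightarrow>
       wait_op (cli (ex i) p) = Some (oc, t) \<or> query_op (cli (ex i) p) = Some oc"
    "query_op (cli (ex (Suc i)) p) = query_op (cli (ex i) p) \<Longrightarrow>
       wait_op (cli (ex (Suc i)) p) = wait_op (cli (ex i) p) \<Longrightarrow>
       responders (cli (ex i) p) t \<subseteq> responders (cli (ex (Suc i)) p) t"
proof -
  have "(query_op (cli (ex (Suc i)) p) = Some oc \<longrightarrow>
      query_op (cli (ex i) p) = Some oc \<or> oc = Suc (cnt (cli (ex i) p))) \<and>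
    cnt (cli (ex i) p) \<le> cnt (cli (ex (Suc i)) p) \<and>
    (query_op (cli (ex i) p) = Some oc \<longrightarrow> ph (cli (ex (Suc i)) p) \<noteq> Idle \<longrightarrow>
       query_op (cli (ex (Suc i)) p) = Some oc \<or> (\<exists>t. wait_op (cli (ex (Suc i)) p) = Some (oc, t))) \<and>
    (wait_op (cli (ex i) p) = Some x \<longrightarrow> ph (cli (ex (Suc i)) p) \<noteq> Idle \<longrightarrow>
       wait_op (cli (ex (Suc i)) p) = Some x) \<and>
    (wait_op (cli (ex (Suc i)) p) = Some (oc, t) \<longrightarrow>
       wait_op (cli (ex i) p) = Some (oc, t) \<or> query_op (cli (ex i) p) = Some oc) \<and>
    (query_op (cli (ex (Suc i)) p) = query_op (cli (ex i) p) \<longrightarrow>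
       wait_op (cli (ex (Suc i)) p) = wait_op (cli (ex i) p) \<longrightarrow>
       responders (cli (ex i) p) t \<subseteq> responders (cli (ex (Suc i)) p) t)"
  proof (cases "cli (ex (Suc i)) p = cli (ex i) p")
    case False
    then show ?thesis
    proof (cases rule: cli_change)
      case (recv src m Os Os')
      note tr = cli_event_trans[OF recv]
      show ?thesis
        by (intro conjI impI; (rule tr(3) tr(4) tr(5) tr(6); assumption)?) (use tr(1,2) in auto)
    next
      case (inv inp Os Os')
      then show ?thesis
        by (cases rule: inv_event_cases) (simp_all add: query_op_def wait_op_def responders_def)
    qed
  qed simp
  then show "query_op (cli (ex (Suc i)) p) = Some oc \<Longrightarrow>
      query_op (cli (ex i) p) = Some oc \<or> oc = Suc (cnt (cli (ex i) p))"
    "cnt (cli (ex i) p) \<le> cnt (cli (ex (Suc i)) p)"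
    "query_op (cli (ex i) p) = Some oc \<Longrightarrow> ph (cli (ex (Suc i)) p) \<noteq> Idle \<Longrightarrow>
       query_op (cli (ex (Suc i)) p) = Some oc \<or> (\<exists>t. wait_op (cli (ex (Suc i)) p) = Some (oc, t))"
    "wait_op (cli (ex i) p) = Some x \<Longrightarrow> ph (cli (ex (Suc i)) p) \<noteq> Idle \<Longrightarrow>
       wait_op (cli (ex (Suc i)) p) = Some x"
    "wait_op (cli (ex (Suc i)) p) = Some (oc, t) \<Longrightarrow>
       wait_op (cli (ex i) p) = Some (oc, t) \<or> query_op (cli (ex i) p) = Some oc"
    "query_op (cli (ex (Suc i)) p) = query_op (cli (ex i) p) \<Longrightarrow>
       wait_op (cli (ex (Suc i)) p) = wait_op (cli (ex i) p) \<Longrightarrow>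
       responders (cli (ex i) p) t \<subseteq> responders (cli (ex (Suc i)) p) t"
    by auto
qed

text \<open>Once true, \<open>past i p oc\<close> stays true, and it is false while \<open>p\<close> is querying in its operation
number \<open>oc\<close>. It dates messages: one that makes \<open>oc\<close> past was sent after that query phase.\<close>

definition past :: "nat \<Rightarrow> proc \<Rightarrow> nat \<Rightarrow> bool" where
  "past i p oc \<longleftrightarrow> oc \<le> cnt (cli (ex i) p) \<and> (\<forall>oc'. query_op (cli (ex i) p) = Some oc' \<longrightarrow> oc < oc')"

lemma past_mono:
  assumes "past i p oc" "i \<le> k"
  shows "past k p oc"
  using assms(2)
proof (induction rule: dec_induct)
  case (step l)
  have "oc < oc'" if "query_op (cli (ex (Suc l)) p) = Some oc'" for oc'
    using cli_step(1)[OF that] step(3) by (auto simp: past_def)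
  then show ?case using step(3) cli_step(2)[of l p] by (auto simp: past_def)
qed (rule assms(1))

text \<open>Such a message originates only with the writer leaving the query phase of operation
  \<open>oc\<close>; servers merely pass it on. This dates acknowledgements.\<close>

lemma sent_full_past: "sent i p d (VFull t v oc) \<Longrightarrow> past i (Wr (snd t)) oc"
proof (induction i arbitrary: p d)
  case 0
  then show ?case by (simp add: sent_0)
next
  case (Suc i)
  have old: "past (Suc i) (Wr (snd t)) oc" if "sent i p' d' (VFull t v oc)" for p' d'
    using Suc.IH[OF that] by (rule past_mono) simp
  show ?case
  proof (cases "sent i p d (VFull t v oc)")
    case False
    with Suc.prems show ?thesis
    proof (cases rule: new_sent)
      case (server j src m' Os Os')
      from server(2) obtain eo u where r: "srv_recv P j src m' eo (srv (ex i) j) = (srv (ex (Suc i)) j, Os, u)"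
        by (rule srv_event_run)
      from server(2,3) have "sent i src (Srv j) m'" "(d, VFull t v oc) \<in> set (take (length Os) Os)"
        by (auto simp: srv_event_def sends_def dest: in_set_takeD net_sent)
      from srv_recv_sends_full[OF r finite_registrations this(2)] this(1) show ?thesis
        using old by blast
    next
      case (client src m' Os Os')
      note r = cli_event_facts(1)[OF client(1)]
      have mem: "(d, VFull t v oc) \<in> set Os" by (rule cli_event_facts(4)[OF client])
      from r show ?thesis
      proof (cases rule: cli_recv_cases)
        case (wsend oc' v' S tm j t' w tw)
        then have "t = tw" "oc' = oc" using mem by auto
        then show ?thesis using wsend client_invariant[of i p]
          by (simp add: past_def query_op_def client_inv_def)
      qed (use mem in \<open>auto simp: set_md_meta\<close>)
    next
      case (invoke inp Os Os')
      then show ?thesis by (auto elim: inv_event_sends)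
    qed
  qed (rule old)
qed

text \<open>Forwarding creates no new metadata, because the forwarded item was already carried. What
  remains are the three origins; READ-DISPERSE brings along the response that was sent before it in
  the same step.\<close>

lemma new_carried:
  assumes "carried (Suc i) mm" "\<not> carried i mm"
  obtains (server) t j r c where "mm = ReadDisperse t j r" "sent (Suc i) (Srv j) (Rd (fst r)) (RResp r t c)"
  | (read) r oc tr where "mm = ReadValue (r, oc) tr" "query_op (cli (ex i) (Rd r)) = Some oc"
    "wait_op (cli (ex (Suc i)) (Rd r)) = Some (oc, tr)"
  | (complete) r oc tr where "mm = ReadComplete (r, oc) tr" "wait_op (cli (ex i) (Rd r)) = Some (oc, tr)"
    "ph (cli (ex (Suc i)) (Rd r)) = Idle" "past i (Rd r) oc"
proof -
  obtain p d m where m: "sent (Suc i) p d m" "carries_meta m mm" using assms(1) by (auto simp: carried_def)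
  then have "\<not> sent i p d m" using assms(2) by (auto simp: carried_def)
  with m(1) show thesis
  proof (cases rule: new_sent)
    case (server j src m' Os Os')
    from server(2) obtain eo u where r: "srv_recv P j src m' eo (srv (ex i) j) = (srv (ex (Suc i)) j, Os, u)"
      by (rule srv_event_run)
    from server(2) obtain k where k: "sent i src (Srv j) m'" "Os' = take k Os"
      by (auto simp: srv_event_def sends_def dest: net_sent)
    have "\<not> carries_meta m' mm" using k(1) assms(2) by (auto simp: carried_def)
    then obtain t r c where resp: "mm = ReadDisperse t j r" "(Rd (fst r), RResp r t c) \<in> set Os'"
      using srv_recv_sends_meta[OF r finite_registrations, of d m k mm] server(3) k(2) m(2) by blast
    then have "sent (Suc i) (Srv j) (Rd (fst r)) (RResp r t c)"
      using server(2) by (auto simp: srv_event_def dest: packets_sent)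
    with resp(1) show thesis by (rule that(1))
  next
    case (client src m' Os Os')
    note r = cli_event_facts(1)[OF client(1)]
    have mem: "(d, m) \<in> set Os" by (rule cli_event_facts(4)[OF client])
    from r show thesis
    proof (cases rule: cli_recv_cases)
      case (rsend oc S tm j t r)
      then have "mm = ReadValue (r, oc) (max tm t)" using mem m(2) by (auto simp: set_md_meta)
      then show thesis using rsend by (intro that(2)[of r oc "max tm t"]) (simp_all add: query_op_def wait_op_def)
    next
      case (rdone oc tr M r v)
      then have "mm = ReadComplete (r, oc) tr" using mem m(2) by (auto simp: set_md_meta)
      then show thesis using rdone client_invariant[of i p]
        by (intro that(3)[of r oc tr]) (simp_all add: query_op_def wait_op_def past_def client_inv_def)
    qed (use mem m(2) in auto)
  next
    case (invoke inp Os Os')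
    then show thesis using m(2) by (auto elim: inv_event_sends)
  qed
qed

lemma query_not_waiting: "query_op C = Some oc \<Longrightarrow> wait_op C = None"
  by (auto simp: query_op_def wait_op_def split: phase.splits)

text \<open>READ-VALUE is issued only on leaving the query phase, and a past operation never queries
  again. Each read therefore announces a single request tag.\<close>

lemma carried_value:
  "carried i (ReadValue (r, oc) tr) \<Longrightarrow> past i (Rd r) oc \<and>
     (\<forall>tr'. wait_op (cli (ex i) (Rd r)) = Some (oc, tr') \<longrightarrow> tr' = tr)"
proof (induction i)
  case 0
  then show ?case by (simp add: carried_def sent_0)
next
  case (Suc i)
  show ?case
  proof (cases "carried i (ReadValue (r, oc) tr)")
    case True
    then show ?thesis
      using Suc.IH past_mono[of i "Rd r" oc "Suc i"] cli_step(5)[of i "Rd r" oc] by (auto simp: past_def)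
  next
    case False
    with Suc.prems show ?thesis
    proof (cases rule: new_carried)
      case (read r' oc' tr')
      then have "oc = cnt (cli (ex i) (Rd r))" using client_invariant[of i "Rd r"]
        by (auto simp: query_op_def client_inv_def split: phase.splits)
      then show ?thesis using read cli_step(2)[of i "Rd r"] query_not_waiting[of "cli (ex (Suc i)) (Rd r)"]
        by (auto simp: past_def)
    qed simp_all
  qed
qed

text \<open>READ-COMPLETE is sent in the step that ends the wait, and waiting in \<open>oc\<close>
  again would require querying in \<open>oc\<close> again, which \<open>past\<close>
  excludes.\<close>

lemma carried_complete:
  "carried i (ReadComplete (r, oc) tr) \<Longrightarrow> past i (Rd r) oc \<and>
     (\<forall>tr'. wait_op (cli (ex i) (Rd r)) \<noteq> Some (oc, tr'))"
proof (induction i)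
  case 0
  then show ?case by (simp add: carried_def sent_0)
next
  case (Suc i)
  show ?case
  proof (cases "carried i (ReadComplete (r, oc) tr)")
    case True
    then show ?thesis
      using Suc.IH past_mono[of i "Rd r" oc "Suc i"] cli_step(5)[of i "Rd r" oc] by (auto simp: past_def)
  next
    case False
    with Suc.prems show ?thesis
    proof (cases rule: new_carried)
      case (complete r' oc' tr')
      then show ?thesis using past_mono[of i "Rd r" oc "Suc i"] by (auto simp: wait_op_def)
    qed simp_all
  qed
qed

lemma server_carried:
  "mm \<in> mseen (srv (ex i) j) \<Longrightarrow> carried i mm"
  "(r, tr) \<in> sR (srv (ex i) j) \<Longrightarrow> ReadValue r tr \<in> mseen (srv (ex i) j)"
proof -
  have "(\<forall>mm \<in> mseen (srv (ex i) j). carried i mm) \<and>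
      (\<forall>x \<in> sR (srv (ex i) j). ReadValue (fst x) (snd x) \<in> mseen (srv (ex i) j))"
  proof (induction i)
    case 0
    then show ?case by (simp add: ex_0 init_def)
  next
    case (Suc i)
    have old: "\<forall>mm \<in> mseen (srv (ex i) j). carried (Suc i) mm" using Suc carried_mono[of i _ "Suc i"] by auto
    show ?case
    proof (cases "srv (ex (Suc i)) j = srv (ex i) j")
      case False
      then obtain src m Os Os' where ev: "srv_event i j src m Os Os'" by (rule srv_change)
      then obtain eo u where r: "srv_recv P j src m eo (srv (ex i) j) = (srv (ex (Suc i)) j, Os, u)"
        by (rule srv_event_run)
      note st = srv_recv_state[OF r finite_registrations]
      have "sent (Suc i) src (Srv j) m" using ev by (auto simp: srv_event_def intro: sent_Suc net_sent)
      then have "\<forall>mm \<in> mseen (srv (ex (Suc i)) j). carried (Suc i) mm"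
        using st(6) old unfolding carried_def by blast
      moreover have "\<forall>x \<in> sR (srv (ex (Suc i)) j). ReadValue (fst x) (snd x) \<in> mseen (srv (ex (Suc i)) j)"
        using st(4,5) Suc by fastforce
      ultimately show ?thesis by blast
    qed (use old Suc in simp)
  qed
  then show "mm \<in> mseen (srv (ex i) j) \<Longrightarrow> carried i mm"
    "(r, tr) \<in> sR (srv (ex i) j) \<Longrightarrow> ReadValue r tr \<in> mseen (srv (ex i) j)" by force+
qed

text \<open>This dates responses through the READ-VALUE they presuppose, and later shows that a
  server has not answered a read before its first READ-VALUE.\<close>

lemma resp_registered: "sent i (Srv s) d (RResp r t c) \<Longrightarrow> \<exists>tr. ReadValue r tr \<in> mseen (srv (ex i) s)"
proof (induction i)
  case 0
  then show ?case by (simp add: sent_0)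
next
  case (Suc i)
  show ?case
  proof (cases "sent i (Srv s) d (RResp r t c)")
    case True
    then show ?thesis using Suc.IH server_mono[of i "Suc i" s] by auto
  next
    case False
    with Suc.prems show ?thesis
    proof (cases rule: new_sent)
      case (server j src m' Os Os')
      from server(2) obtain eo u where r: "srv_recv P j src m' eo (srv (ex i) j) = (srv (ex (Suc i)) j, Os, u)"
        by (rule srv_event_run)
      from server(2,3) have "(d, RResp r t c) \<in> set Os"
        by (auto simp: srv_event_def sends_def dest: in_set_takeD)
      from srv_recv_sends_resp[OF r finite_registrations this] show ?thesis
        using server(1) server_carried(2)[of r _ i j] server_mono[of i "Suc i" j] by simp blast
    next
      case (client src m' Os Os')
      then show ?thesis using cli_event_facts(6)[OF client(1)] by (simp add: is_client_def)
    next
      case (invoke inp Os Os')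
      then show ?thesis by (auto elim: inv_event_sends)
    qed
  qed
qed

text \<open>It holds even if \<open>s\<close> crashes while announcing, since the response comes
  first in the output.\<close>

lemma disperse_resp:
  "carried i (ReadDisperse t s r) \<Longrightarrow> \<exists>c. sent i (Srv s) (Rd (fst r)) (RResp r t c)"
proof (induction i)
  case 0
  then show ?case by (simp add: carried_def sent_0)
next
  case (Suc i)
  show ?case
  proof (cases "carried i (ReadDisperse t s r)")
    case True
    then show ?thesis using Suc.IH sent_Suc by blast
  next
    case False
    with Suc.prems show ?thesis by (cases rule: new_carried) auto
  qed
qed

text \<open>The second alternative is unavoidable, as a READ-COMPLETE marker looks like a response
  record. Survival of \<open>j\<close> is required because \<open>j\<close> may record its own
  response and crash before sending it.\<close>

lemma history_resp:
  "(t, s, r) \<in> sH (srv (ex i) j) \<Longrightarrow> Srv j \<notin> crashed (ex i) \<Longrightarrow>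
    (\<exists>c. sent i (Srv s) (Rd (fst r)) (RResp r t c)) \<or> (\<exists>tr. carried i (ReadComplete r tr))"
proof (induction i)
  case 0
  then show ?case by (simp add: ex_0 init_def)
next
  case (Suc i)
  show ?case
  proof (cases "(t, s, r) \<in> sH (srv (ex i) j)")
    case True
    moreover have "Srv j \<notin> crashed (ex i)" using Suc.prems(2) crashed_mono[of i "Suc i"] by auto
    ultimately show ?thesis using Suc.IH sent_Suc carried_mono[of i _ "Suc i"] by (meson le_SucI order_refl)
  next
    case False
    then have "srv (ex (Suc i)) j \<noteq> srv (ex i) j" using Suc.prems(1) by auto
    then obtain src m Os Os' where ev: "srv_event i j src m Os Os'" by (rule srv_change)
    then obtain eo u where r: "srv_recv P j src m eo (srv (ex i) j) = (srv (ex (Suc i)) j, Os, u)"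
      by (rule srv_event_run)
    have "sent (Suc i) src (Srv j) m" using ev by (auto simp: srv_event_def intro: sent_Suc net_sent)
    then have car: "carried (Suc i) mm" if "carries_meta m mm" for mm
      using that by (auto simp: carried_def)
    have "Os' = Os" using ev Suc.prems(2) by (auto simp: srv_event_def sends_def)
    then have "sent (Suc i) (Srv j) d m'" if "(d, m') \<in> set Os" for d m'
      using ev that by (auto simp: srv_event_def dest: packets_sent)
    then show ?thesis
      using srv_recv_history[OF r finite_registrations Suc.prems(1) False] car disperse_resp by blast
  qed
qed

subsection \<open>Termination\<close>

lemma responders_persist:
  assumes "\<And>k. k \<ge> a \<Longrightarrow> query_op (cli (ex k) p) = q \<and> wait_op (cli (ex k) p) = w"
    and "s \<in> responders (cli (ex l) p) t" "a \<le> l" "l \<le> k"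
  shows "s \<in> responders (cli (ex k) p) t"
  using assms(4)
proof (induction rule: dec_induct)
  case (step j)
  have "responders (cli (ex j) p) t \<subseteq> responders (cli (ex (Suc j)) p) t"
    by (rule cli_step(6)) (use assms(1)[of j] assms(1)[of "Suc j"] assms(3) step in auto)
  then show ?case using step by blast
qed (rule assms(2))

text \<open>Replies counted at different times are all still counted at a common later time, since
  \<open>responders\<close> only grows within a phase and \<open>X\<close> is finite.\<close>

lemma collects_responses:
  assumes "\<And>k. k \<ge> a \<Longrightarrow> query_op (cli (ex k) p) = q \<and> wait_op (cli (ex k) p) = w"
    and "finite X" "\<And>s. s \<in> X \<Longrightarrow> \<exists>l\<ge>a. s \<in> responders (cli (ex l) p) t"
  shows "\<exists>k\<ge>a. X \<subseteq> responders (cli (ex k) p) t"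
proof -
  have "\<exists>N. \<forall>k\<ge>N. \<forall>s\<in>X. s \<in> responders (cli (ex k) p) t"
  proof (rule finite_eventually_all[OF assms(2)])
    fix s assume "s \<in> X"
    then obtain l where "l \<ge> a" "s \<in> responders (cli (ex l) p) t" using assms(3) by blast
    then show "\<exists>N. \<forall>k\<ge>N. s \<in> responders (cli (ex k) p) t"
      using responders_persist[of a p q w, OF assms(1)] by blast
  qed
  then obtain N where "\<forall>s\<in>X. s \<in> responders (cli (ex k) p) t" if "k \<ge> N" for k by blast
  from this[of "max a N"] show ?thesis by (intro exI[of _ "max a N"]) auto
qed

lemma query_terminates:
  assumes alive: "\<forall>i. p \<notin> crashed (ex i)" and client: "is_client p"
    and query: "\<And>k. k \<ge> a \<Longrightarrow> query_op (cli (ex k) p) = Some oc"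
    and sent: "\<And>s. s < pn P \<Longrightarrow> (n0, p, Srv s, QTag oc) \<in> net (ex a)"
  shows False
proof -
  have q: "query_op (cli (ex k) p) = Some oc \<and> wait_op (cli (ex k) p) = None" if "k \<ge> a" for k
    using query[OF that] query_not_waiting by blast
  have "\<exists>l\<ge>a. s \<in> responders (cli (ex l) p) t0" if s: "s \<in> correct" for s
  proof -
    have "(n0, p, Srv s, QTag oc) \<in> net (ex a)" using s sent by (simp add: correct_def)
    then obtain l Os where l: "a \<le> l" "srv_event l s p (QTag oc) Os Os" using s by (rule server_delivery)
    define tg where "tg = stag (srv (ex l) s)"
    have "Os = [(p, RTag oc tg)]"
      using l(2) by (auto simp: srv_event_def srv_recv_def tg_def)
    then have "(nid (ex l), Srv s, p, RTag oc tg) \<in> net (ex (Suc l))"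
      using srv_event_packet[OF l(2)] by simp
    then obtain l' Os' where l': "Suc l \<le> l'" "cli_event l' p (Srv s) (RTag oc tg) Os' Os'"
      using alive client by (rule client_delivery)
    have q': "query_op (cli (ex l') p) = Some oc" "query_op (cli (ex (Suc l')) p) = Some oc"
      using query l(1) l'(1) by simp_all
    have "s \<in> responders (cli (ex (Suc l')) p) t0"
    proof (cases "ph (cli (ex l') p)")
      case (WQuery oc1 v S tm)
      then obtain w where "p = Wr w" using client_invariant[of l' p] by (auto simp: client_inv_def)
      then obtain oc2 v' S' tm' where "ph (cli (ex (Suc l')) p) = WQuery oc2 v' S' tm'"
        using q'(2) client_invariant[of "Suc l'" p]
        by (auto simp: query_op_def client_inv_def split: phase.splits)
      moreover have "oc1 = oc" using q'(1) WQuery by (simp add: query_op_def)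
      ultimately show ?thesis
        using cli_recv_tag(1)[OF cli_event_facts(1)[OF l'(2)] WQuery[unfolded \<open>oc1 = oc\<close>] \<open>p = Wr w\<close>]
        by (simp add: responders_def)
    next
      case (RQuery oc1 S tm)
      then obtain r where "p = Rd r" using client_invariant[of l' p] by (auto simp: client_inv_def)
      then obtain oc2 S' tm' where "ph (cli (ex (Suc l')) p) = RQuery oc2 S' tm'"
        using q'(2) client_invariant[of "Suc l'" p]
        by (auto simp: query_op_def client_inv_def split: phase.splits)
      moreover have "oc1 = oc" using q'(1) RQuery by (simp add: query_op_def)
      ultimately show ?thesis
        using cli_recv_tag(2)[OF cli_event_facts(1)[OF l'(2)] RQuery[unfolded \<open>oc1 = oc\<close>] \<open>p = Rd r\<close>]
        by (simp add: responders_def)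
    qed (use q'(1) in \<open>auto simp: query_op_def\<close>)
    then show ?thesis using l(1) l'(1) by (intro exI[of _ "Suc l'"]) simp
  qed
  from collects_responses[of a p, OF q finite_correct this]
  obtain k where k: "k \<ge> a" "correct \<subseteq> responders (cli (ex k) p) t0" by blast
  have "finite (responders (cli (ex k) p) t0) \<and> 2 * card (responders (cli (ex k) p) t0) \<le> pn P"
    using query[OF k(1)] client_invariant[of k p]
    by (auto simp: query_op_def client_inv_def responders_def split: phase.splits)
  \<comment> \<open>With \<open>2f + 1 <= n\<close>, the at least \<open>n - f\<close> correct
    servers form a strict majority, so the query would have ended.\<close>
  then have "2 * card correct \<le> pn P" using card_mono[OF _ k(2)] by fastforce
  then show False using card_correct majority by linarith
qed

lemma past_after_query: "query_op (cli (ex c) p) = Some oc \<Longrightarrow> past i p oc \<Longrightarrow> c < i"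
  using past_mono[of i p oc c] by (force simp: past_def not_le[symmetric])

lemma write_terminates:
  assumes alive: "\<forall>i. Wr w \<notin> crashed (ex i)"
    and query: "query_op (cli (ex c) (Wr w)) = Some oc"
    and wait: "\<And>k. k > c \<Longrightarrow> wait_op (cli (ex k) (Wr w)) = Some (oc, tw)"
  shows False
proof -
  have waiting: "\<exists>A. ph (cli (ex k) (Wr w)) = WWait oc tw A \<and> responders (cli (ex k) (Wr w)) t = A" if "k > c" for k t
    using wait[OF that] client_invariant[of k "Wr w"]
    by (auto simp: wait_op_def client_inv_def responders_def split: phase.splits)
  have q: "query_op (cli (ex k) (Wr w)) = None \<and> wait_op (cli (ex k) (Wr w)) = Some (oc, tw)" if "k \<ge> Suc c" for k
    using wait[of k] query_not_waiting[of "cli (ex k) (Wr w)"] that by fastforce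
  obtain A0 where A0: "ph (cli (ex (Suc c)) (Wr w)) = WWait oc tw A0" using waiting[of "Suc c" t0] by blast
  have "snd tw = w \<and> (\<exists>v. full_sent (Suc c) tw v oc)"
    using client_invariant[of "Suc c" "Wr w"] alive unfolding client_inv_def A0 phase.case by blast
  then obtain v where full: "full_sent (Suc c) tw v oc" and tw: "snd tw = w" by blast
  have "\<exists>l\<ge>Suc c. s \<in> responders (cli (ex l) (Wr w)) t0" if s: "s \<in> correct" for s
  proof -
    obtain k where "(tw, oc) \<in> vseen (srv (ex k) s)" using full_sent_seen[OF full s] by blast
    then obtain l src m Os where l: "(tw, oc) \<notin> vseen (srv (ex l) s)" "(tw, oc) \<in> vseen (srv (ex (Suc l)) s)"
      "srv_event l s src m Os Os" by (rule first_seen[OF _ s])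
    from l(3) obtain eo u where r: "srv_recv P s src m eo (srv (ex l) s) = (srv (ex (Suc l)) s, Os, u)"
      by (rule srv_event_run)
    have "(Wr w, Ack tw oc) \<in> set Os"
      using srv_recv_value_emits(1)[OF r finite_registrations l(2,1)] tw by simp
    then have packet: "(nid (ex l), Srv s, Wr w, Ack tw oc) \<in> net (ex (Suc l))"
      by (rule srv_event_packet[OF l(3)])
    \<comment> \<open>An acknowledgement arriving during the query phase would be ignored. Its
      existence implies that the full value was already sent, hence that the query phase was over;
      relay 0 serves as a witness.\<close>
    obtain v' where "full_sent (Suc l) tw v' oc"
      using seen_full_sent[OF l(2)] s by (auto simp: correct_def)
    then obtain q where "sent (Suc l) q (Srv 0) (VFull tw v' oc)" by (auto simp: full_sent_def)
    then have "c < Suc l" using past_after_query[OF query] sent_full_past tw by blast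
    obtain l' Os' where l': "Suc l \<le> l'" "cli_event l' (Wr w) (Srv s) (Ack tw oc) Os' Os'"
      by (rule client_delivery[OF packet alive]) (simp add: is_client_def)
    obtain A A' where "ph (cli (ex l') (Wr w)) = WWait oc tw A" "ph (cli (ex (Suc l')) (Wr w)) = WWait oc tw A'"
      "responders (cli (ex (Suc l')) (Wr w)) t0 = A'"
      using waiting[of l' t0] waiting[of "Suc l'" t0] \<open>c < Suc l\<close> l'(1) by auto
    then have "s \<in> responders (cli (ex (Suc l')) (Wr w)) t0"
      using cli_recv_ack[OF cli_event_facts(1)[OF l'(2)]] by simp
    then show ?thesis using \<open>c < Suc l\<close> l'(1) by (intro exI[of _ "Suc l'"]) simp
  qed
  from collects_responses[of "Suc c" "Wr w", OF q finite_correct this]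
  obtain k where k: "k \<ge> Suc c" "correct \<subseteq> responders (cli (ex k) (Wr w)) t0" by blast
  obtain A where A: "ph (cli (ex k) (Wr w)) = WWait oc tw A" "responders (cli (ex k) (Wr w)) t0 = A"
    using waiting[of k t0] k(1) by auto
  then have "finite A" "card A < kk P"
    using client_invariant[of k "Wr w"] by (simp_all add: client_inv_def)
  moreover from this(1) have "card correct \<le> card A" using k(2) A(2) by (intro card_mono) simp_all
  ultimately show False using card_correct kk_total by linarith
qed

text \<open>The form in which both halves of the read argument use the quorum: a responder may even
  have crashed, as only the sending of its response counts.\<close>

lemma no_common_tag:
  assumes alive: "\<forall>i. Rd r \<notin> crashed (ex i)"
    and query: "query_op (cli (ex c) (Rd r)) = Some oc"
    and wait: "\<And>k. k > c \<Longrightarrow> wait_op (cli (ex k) (Rd r)) = Some (oc, tr)"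
    and resp: "\<And>s. s \<in> X \<Longrightarrow> \<exists>i c. sent i (Srv s) (Rd r) (RResp (r, oc) t c)"
    and X: "finite X" "kk P + 2 * pe P \<le> card X"
  shows False
proof -
  have waiting: "\<exists>M. ph (cli (ex k) (Rd r)) = RWait oc tr M \<and> responders (cli (ex k) (Rd r)) t = {x. M x t \<noteq> None}"
    if "k > c" for k
    using wait[OF that] client_invariant[of k "Rd r"]
    by (auto simp: wait_op_def client_inv_def responders_def split: phase.splits)
  have q: "query_op (cli (ex k) (Rd r)) = None \<and> wait_op (cli (ex k) (Rd r)) = Some (oc, tr)" if "k \<ge> Suc c" for k
    using wait[of k] query_not_waiting[of "cli (ex k) (Rd r)"] that by fastforce
  have "\<exists>l\<ge>Suc c. s \<in> responders (cli (ex l) (Rd r)) t" if s: "s \<in> X" for s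
  proof -
    obtain i d where "sent i (Srv s) (Rd r) (RResp (r, oc) t d)" using resp[OF s] by blast
    then obtain l n0 where packet: "(n0, Srv s, Rd r, RResp (r, oc) t d) \<in> net (ex l)" by (auto simp: sent_def)
    \<comment> \<open>The response presupposes a READ-VALUE of this operation, so its packet is in
      transit after the query phase and reaches a waiting reader.\<close>
    obtain tr' where "carried l (ReadValue (r, oc) tr')"
      using resp_registered[OF net_sent[OF packet]] server_carried(1) by blast
    then have "c < l" using past_after_query[OF query] carried_value by blast
    obtain l' Os' where l': "l \<le> l'" "cli_event l' (Rd r) (Srv s) (RResp (r, oc) t d) Os' Os'"
      by (rule client_delivery[OF packet alive]) (simp add: is_client_def)
    obtain M M' where "ph (cli (ex l') (Rd r)) = RWait oc tr M" "ph (cli (ex (Suc l')) (Rd r)) = RWait oc tr M'"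
      "responders (cli (ex (Suc l')) (Rd r)) t = {x. M' x t \<noteq> None}"
      using waiting[of l'] waiting[of "Suc l'"] \<open>c < l\<close> l'(1) by auto
    then have "s \<in> responders (cli (ex (Suc l')) (Rd r)) t"
      using cli_recv_resp[OF cli_event_facts(1)[OF l'(2)]] by simp
    then show ?thesis using \<open>c < l\<close> l'(1) by (intro exI[of _ "Suc l'"]) simp
  qed
  from collects_responses[of "Suc c" "Rd r", OF q X(1) this]
  obtain k where k: "k \<ge> Suc c" "X \<subseteq> responders (cli (ex k) (Rd r)) t" by blast
  obtain M where M: "ph (cli (ex k) (Rd r)) = RWait oc tr M"
    "responders (cli (ex k) (Rd r)) t = {x. M x t \<noteq> None}"
    using waiting[of k] k(1) by auto
  then have "finite {x. M x t \<noteq> None}" "card {x. M x t \<noteq> None} < kk P + 2 * pe P"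
    using client_invariant[of k "Rd r"] by (simp_all add: client_inv_def)
  moreover from this(1) have "card X \<le> card {x. M x t \<noteq> None}" using k(2) M(2) by (intro card_mono) simp_all
  ultimately show False using X(2) by linarith
qed

lemma read_terminates:
  assumes alive: "\<forall>i. Rd r \<notin> crashed (ex i)"
    and query: "query_op (cli (ex c) (Rd r)) = Some oc"
    and wait: "\<And>k. k > c \<Longrightarrow> wait_op (cli (ex k) (Rd r)) = Some (oc, tr)"
  shows False
proof -
  note no_quorum = no_common_tag[OF alive query wait]
  have open_read: "\<not> carried i (ReadComplete (r, oc) tr')" for i tr'
  proof
    assume "carried i (ReadComplete (r, oc) tr')"
    \<comment> \<open>The time is moved beyond \<open>c\<close>, because
      \<open>carried_complete\<close> contradicts only a waiting reader.\<close>
    then have "carried (max i (Suc c)) (ReadComplete (r, oc) tr')" by (rule carried_mono) simp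
    then show False using carried_complete wait[of "max i (Suc c)"] by fastforce
  qed
  have unique: "tr' = tr" if "carried i (ReadValue (r, oc) tr')" for i tr'
  proof -
    have "carried (max i (Suc c)) (ReadValue (r, oc) tr')" using that by (rule carried_mono) simp
    then show ?thesis using carried_value wait[of "max i (Suc c)"] by fastforce
  qed
  obtain M where "ph (cli (ex (Suc c)) (Rd r)) = RWait oc tr M"
    using wait[of "Suc c"] client_invariant[of "Suc c" "Rd r"]
    by (auto simp: wait_op_def client_inv_def split: phase.splits)
  then have relayed: "relayed (Suc c) (ReadValue (r, oc) tr)" and tr: "disseminated (Suc c) tr"
    using client_invariant[of "Suc c" "Rd r"] alive by (auto simp: client_inv_def)
  have "\<exists>l. vseen (srv (ex (Suc l)) s) = vseen (srv (ex l) s) \<and>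
      (\<forall>k\<ge>Suc l. ((r, oc), tr) \<in> sR (srv (ex k) s)) \<and>
      (tr \<le> stag (srv (ex l) s) \<longrightarrow>
        (\<exists>i d. sent i (Srv s) (Rd r) (RResp (r, oc) (stag (srv (ex l) s)) d)))" if s: "s \<in> correct" for s
  proof -
    have alive_s: "Srv s \<notin> crashed (ex i)" for i using s by (simp add: correct_def)
    obtain k where "ReadValue (r, oc) tr \<in> mseen (srv (ex k) s)" using relayed_seen[OF relayed s] by blast
    then obtain l src m Os where l: "ReadValue (r, oc) tr \<notin> mseen (srv (ex l) s)"
      "ReadValue (r, oc) tr \<in> mseen (srv (ex (Suc l)) s)" "srv_event l s src m Os Os"
      by (rule first_meta_seen[OF _ s])
    from l(3) obtain eo u where run: "srv_recv P s src m eo (srv (ex l) s) = (srv (ex (Suc l)) s, Os, u)"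
      by (rule srv_event_run)
    \<comment> \<open>The cancelling marker cannot be present: no READ-COMPLETE exists, and a
      genuine response of \<open>s\<close> with tag \<open>t0\<close> would presuppose a READ-VALUE
      with tag \<open>tr\<close> seen before this first receipt.\<close>
    have "(t0, s, (r, oc)) \<notin> sH (srv (ex l) s)"
    proof
      assume "(t0, s, (r, oc)) \<in> sH (srv (ex l) s)"
      then obtain d where "sent l (Srv s) (Rd r) (RResp (r, oc) t0 d)"
        using history_resp[OF _ alive_s] open_read by fastforce
      then obtain tr' where tr': "ReadValue (r, oc) tr' \<in> mseen (srv (ex l) s)" using resp_registered by blast
      then show False using server_carried(1) unique l(1) by blast
    qed
    note reg = srv_recv_register[OF run finite_registrations l(2,1) this]
    have "((r, oc), tr) \<in> sR (srv (ex k) s)" if "k \<ge> Suc l" for k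
      using that
    proof (induction rule: dec_induct)
      case base
      then show ?case by (rule reg(1))
    next
      case (step k)
      show ?case
      proof (rule ccontr)
        assume gone: "((r, oc), tr) \<notin> sR (srv (ex (Suc k)) s)"
        then have "srv (ex (Suc k)) s \<noteq> srv (ex k) s" using step by auto
        then obtain src m Os Os' where ev: "srv_event k s src m Os Os'" by (rule srv_change)
        then obtain eo u where r: "srv_recv P s src m eo (srv (ex k) s) = (srv (ex (Suc k)) s, Os, u)"
          by (rule srv_event_run)
        have "sent k src (Srv s) m" using ev by (auto simp: srv_event_def intro: net_sent)
        then have car: "carried k mm" if "carries_meta m mm" for mm
          using that by (auto simp: carried_def)
        \<comment> \<open>With READ-COMPLETE excluded, only a full set of history entries can drop
          the registration, and each entry stands for a response that was sent.\<close>
        from srv_recv_unregister[OF r finite_registrations step(3) gone] car open_read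
        obtain t x where x: "carried k (ReadDisperse t x (r, oc))"
          "kk P + 2 * pe P \<le> card {y. (t, y, (r, oc)) \<in> insert (t, x, (r, oc)) (sH (srv (ex k) s))}"
          by blast
        let ?X = "{y. (t, y, (r, oc)) \<in> insert (t, x, (r, oc)) (sH (srv (ex k) s))}"
        show False
        proof (rule no_quorum)
          show "kk P + 2 * pe P \<le> card ?X" by (rule x(2))
          \<comment> \<open>Infinite sets have cardinality 0, so the positive lower bound yields
            finiteness.\<close>
          then show "finite ?X" using kk_pos by (intro card_ge_0_finite) linarith
          fix y assume "y \<in> ?X"
          then consider "y = x" | "(t, y, (r, oc)) \<in> sH (srv (ex k) s)" by auto
          then show "\<exists>i c. sent i (Srv y) (Rd r) (RResp (r, oc) t c)"
          proof cases
            case 1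
            then show ?thesis using disperse_resp[OF x(1)] by auto
          next
            case 2
            then show ?thesis using history_resp[OF _ alive_s] open_read by fastforce
          qed
        qed
      qed
    qed
    moreover have "\<exists>i d. sent i (Srv s) (Rd r) (RResp (r, oc) (stag (srv (ex l) s)) d)"
      if "tr \<le> stag (srv (ex l) s)"
      using reg(2)[OF that] srv_event_packet[OF l(3)] net_sent by (metis fst_conv)
    ultimately show ?thesis using reg(3) by blast
  qed
  \<comment> \<open>\<open>T s\<close> is the step in which \<open>s\<close> registers the read,
    chosen for each correct server.\<close>
  then obtain T where T: "\<And>s. s \<in> correct \<Longrightarrow> vseen (srv (ex (Suc (T s))) s) = vseen (srv (ex (T s)) s)"
    "\<And>s k. s \<in> correct \<Longrightarrow> k \<ge> Suc (T s) \<Longrightarrow> ((r, oc), tr) \<in> sR (srv (ex k) s)"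
    "\<And>s. s \<in> correct \<Longrightarrow> tr \<le> stag (srv (ex (T s)) s) \<Longrightarrow>
       \<exists>i d. sent i (Srv s) (Rd r) (RResp (r, oc) (stag (srv (ex (T s)) s)) d)"
    by metis
  \<comment> \<open>Including \<open>tr\<close> ensures that \<open>top\<close> meets the threshold
    for responses even when all stored tags lie below it.\<close>
  define tags where "tags = insert tr ((\<lambda>s. stag (srv (ex (T s)) s)) ` correct)"
  define top where "top = Max tags"
  have fin: "finite tags" using finite_correct by (simp add: tags_def)
  have "top \<in> tags" unfolding top_def by (rule Max_in[OF fin]) (simp add: tags_def)
  \<comment> \<open>\<open>tr\<close> was obtained from a query, and the other candidates are stored
    by servers that never crash, so \<open>top\<close> is disseminated in either case.\<close>
  then obtain i where top: "disseminated i top"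
    using tr server_tag_disseminated by (auto simp: tags_def correct_def)
  have ge: "t \<le> top" if "t \<in> tags" for t using fin that by (simp add: top_def)
  show False
  proof (rule no_quorum)
    show "finite correct" by (rule finite_correct)
    show "kk P + 2 * pe P \<le> card correct" using card_correct kk_total by simp
    fix s assume s: "s \<in> correct"
    show "\<exists>i d. sent i (Srv s) (Rd r) (RResp (r, oc) top d)"
    proof (cases "stag (srv (ex (T s)) s) = top")
      case True
      then show ?thesis using T(3)[OF s] ge[of tr] by (simp add: tags_def)
    next
      case False
      have "stag (srv (ex (T s)) s) \<le> top" using ge s by (simp add: tags_def)
      with False have less: "stag (srv (ex (T s)) s) < top" by simp
      \<comment> \<open>A tag strictly above a stored one is not initial, so its dissemination comes
        from a full value.\<close>
      moreover have "t0 \<le> t" for t by (simp add: t0_def less_eq_prod_def)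
      ultimately have "top \<noteq> t0" by (metis leD)
      then obtain v oc' where "full_sent i top v oc'" using top by (auto simp: disseminated_def)
      then obtain k where "(top, oc') \<in> vseen (srv (ex k) s)" using full_sent_seen[OF _ s] by blast
      then obtain l src m Os where l: "(top, oc') \<notin> vseen (srv (ex l) s)"
        "(top, oc') \<in> vseen (srv (ex (Suc l)) s)" "srv_event l s src m Os Os" by (rule first_seen[OF _ s])
      from l(3) obtain eo u where run: "srv_recv P s src m eo (srv (ex l) s) = (srv (ex (Suc l)) s, Os, u)"
        by (rule srv_event_run)
      \<comment> \<open>Delivered tags never exceed the stored one, and registering delivers no
        value. Hence \<open>s\<close> delivers \<open>top\<close> after registering the read, and
        answers it then.\<close>
      have "(top, oc') \<notin> vseen (srv (ex (Suc (T s))) s)"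
        using server_tag[of "T s" s] less T(1)[OF s] by (auto dest: leD)
      then have "Suc (T s) \<le> l"
        using server_mono[of "Suc l" "Suc (T s)" s] l(2) by (cases "Suc (T s) \<le> l") auto
      then have "((r, oc), tr) \<in> sR (srv (ex l) s)" by (rule T(2)[OF s])
      moreover have "tr \<le> top" using ge by (simp add: tags_def)
      ultimately obtain d where "(Rd r, RResp (r, oc) top d) \<in> set Os"
        using srv_recv_value_emits(2)[OF run finite_registrations l(2,1)] by fastforce
      then show ?thesis using srv_event_packet[OF l(3)] net_sent by blast
    qed
  qed
qed

lemma operation_completes:
  assumes client: "is_client p" and alive: "\<forall>j. p \<notin> crashed (ex j)" and inv: "invokes_at ex p i"
  shows "completes_after ex p i"
proof (rule ccontr)
  assume "\<not> completes_after ex p i"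
  then have busy: "ph (cli (ex k) p) \<noteq> Idle" if "k > i" for k
    using that by (auto simp: completes_after_def)
  have idle: "ph (cli (ex i) p) = Idle" and "cli (ex (Suc i)) p \<noteq> cli (ex i) p"
    using inv by (auto simp: invokes_at_def)
  from this(2) obtain inp Os where ev: "inv_event i p inp Os Os"
  proof (cases rule: cli_change)
    case (recv src m Os Os')
    from cli_event_facts(1)[OF recv] show thesis
      by (cases rule: cli_recv_cases) (use idle busy[of "Suc i"] in auto)
  next
    case (inv inp Os Os')
    then have "Os' = Os" using alive by (simp add: inv_event_def sends_def)
    with inv show thesis using that by simp
  qed
  define oc where "oc = Suc (cnt (cli (ex i) p))"
  have start: "query_op (cli (ex (Suc i)) p) = Some oc"
    "Os = map (\<lambda>j. (Srv j, QTag oc)) [0..<pn P]"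
    using ev by (cases rule: inv_event_cases; simp add: query_op_def oc_def)+
  have "\<not> (\<forall>k\<ge>Suc i. query_op (cli (ex k) p) = Some oc)"
  proof
    assume all: "\<forall>k\<ge>Suc i. query_op (cli (ex k) p) = Some oc"
    show False
      \<comment> \<open>All packets of one step share the stamp \<open>nid (ex i)\<close>, so it
        serves for every server at once.\<close>
      by (rule query_terminates[OF alive client, of "Suc i" oc "nid (ex i)"])
        (use all ev in \<open>auto simp: inv_event_def packets_def start(2)\<close>)
  qed
  then obtain k where k: "k \<ge> Suc i" "query_op (cli (ex k) p) \<noteq> Some oc" by blast
  \<comment> \<open>\<open>c\<close> is the last moment of the query phase; as the client never
    becomes idle, it waits from \<open>Suc c\<close> on.\<close>
  have "\<exists>c\<ge>Suc i. query_op (cli (ex c) p) = Some oc \<and> query_op (cli (ex (Suc c)) p) \<noteq> Some oc"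
  proof (rule ccontr)
    assume *: "\<not> ?thesis"
    have "query_op (cli (ex k) p) = Some oc"
      using k(1) by (induction rule: dec_induct) (use start(1) * in auto)
    then show False using k(2) by simp
  qed
  then obtain c where c: "c \<ge> Suc i" "query_op (cli (ex c) p) = Some oc"
    "query_op (cli (ex (Suc c)) p) \<noteq> Some oc" by blast
  then obtain t where t: "wait_op (cli (ex (Suc c)) p) = Some (oc, t)"
    using cli_step(3)[OF c(2)] busy[of "Suc c"] by auto
  have wait: "wait_op (cli (ex k) p) = Some (oc, t)" if "k > c" for k
  proof -
    from that have "Suc c \<le> k" by simp
    then show ?thesis
      by (induction rule: dec_induct) (use t cli_step(4) busy c(1) in auto)
  qed
  show False
  proof (cases p)
    case (Wr w)
    then show False using write_terminates[of w c oc t] alive c(2) wait by blast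
  next
    case (Rd r)
    then show False using read_terminates[of r c oc t] alive c(2) wait by blast
  qed (use client in \<open>simp add: is_client_def\<close>)
qed

end

theorem theorem10:
  fixes n f e :: nat
    and Phi :: "nat \<Rightarrow> 'v \<Rightarrow> 'c"
    and Dec :: "nat set \<Rightarrow> (nat \<Rightarrow> 'c) \<Rightarrow> 'v"
    and v0 :: 'v
    and ex :: "nat \<Rightarrow> ('v, 'c) gstate"
    and act :: "nat \<Rightarrow> ('v, 'c) action"
    and p :: proc and i :: nat
  assumes "1 \<le> f" and "2 * f + 1 \<le> n"
    and "mds_code n (n - f - 2 * e) Phi"
    and "err_decoder n (n - f - 2 * e) e Phi Dec"
    and "fair_exec \<lparr>pn = n, pf = f, pe = e, pPhi = Phi, pDec = Dec\<rparr> v0 ex act"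
    and "is_client p"
    and "\<forall>j. p \<notin> crashed (ex j)"
    and "invokes_at ex p i"
  shows "completes_after ex p i"
proof -
  \<comment> \<open>Positivity of \<open>k\<close> is part of \<open>mds_code\<close>.\<close>
  interpret soda_execution "\<lparr>pn = n, pf = f, pe = e, pPhi = Phi, pDec = Dec\<rparr>" v0 ex act
    using assms(2,3,5) by unfold_locales (auto simp: kk_def mds_code_def)
  show ?thesis using assms(6-8) by (rule operation_completes)
qed

end
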